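(* Let $0\le k<1$ and let $\phi(x)=\operatorname{dn}(x,k)$, with fundamental period $T=2K(k)$. Then $\phi$ is spectrally stable with respect to co-periodic perturbations but not with respect to subharmonic perturbations. That is: (i) if $\lambda\in\mathbb C$ and $(U,V)\ne(0,0)$ satisfies $\mathcal L(U,V)^T=\lambda(U,V)^T$ and $(U,V)(x+T)=(U,V)(x)$ for all $x$, then $\operatorname{Re}\lambda=0$; (ii) for every integer $P\ge2$ there exist $\lambda\in\mathbb C$ with $\operatorname{Re}\lambda>0$ and $(U,V)\neq(0,0)$ with $\mathcal L(U,V)^T=\lambda(U,V)^T$ and $(U,V)(x+PT)=(U,V)(x)$ for all $x$.
   Context: $\operatorname{dn}$ is the Jacobi elliptic function of modulus $k$ and $K(k)=\int_0^{\pi/2}(1-k^2\sin^2y)^{-1/2}dy$. $\Psi=e^{-i\omega t}\operatorname{dn}(x,k)$ with $\omega=\tfrac12(k^2-2)$ is a stationary solution of the focusing NLS equation $i\Psi_t+\tfrac12\Psi_{xx}+\Psi|\Psi|^2=0$. Writing $\Psi=e^{-i\omega t}(\phi+\epsilon(u+iv)+\dots)$, the linearization is $\partial_t(u,v)^T=\mathcal L(u,v)^T$ with $$\mathcal L=\begin{pmatrix}0&\mathcal L_-\\-\mathcal L_+&0\end{pmatrix},\qquad \mathcal L_-=-\tfrac12\partial_x^2-\phi^2-\omega,\qquad \mathcal L_+=-\tfrac12\partial_x^2-3\phi^2-\omega .$$ $U,V$ are complex-valued. Subharmonic perturbations are perturbations whose period is an integer multiple $PT$, $P\ge2$, of the fundamental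 period. *)

theory Defs
  imports "HOL-Analysis.Analysis"
begin

text \<open>The integral is the oriented one, so that the amplitude is defined for negative arguments too.\<close>

definition ellF :: "real \<Rightarrow> real \<Rightarrow> real" where
  "ellF k \<theta> = (LBINT y=0..\<theta>. (1 - k\<^sup>2 * (sin y)\<^sup>2) powr (-1/2))"

definition ellK :: "real \<Rightarrow> real" where
  "ellK k = ellF k (pi / 2)"

text \<open>For \<open>\<bar>k\<bar> < 1\<close> the map \<^term>\<open>ellF k\<close> is an increasing bijection of the real line;
  its inverse is the Jacobi amplitude. The parameter \<open>k\<close> is the modulus, not \<open>m = k\<^sup>2\<close>.\<close>

definition jacobi_am :: "real \<Rightarrow> real \<Rightarrow> real" where
  "jacobi_am x k = inv (ellF k) x"

definition jacobi_dn :: "real \<Rightarrow> real \<Rightarrow> real" where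
  "jacobi_dn x k = sqrt (1 - k\<^sup>2 * (sin (jacobi_am x k))\<^sup>2)"

abbreviation D :: "(real \<Rightarrow> complex) \<Rightarrow> real \<Rightarrow> complex" where
  "D U \<equiv> (\<lambda>x. vector_derivative U (at x))"

definition twice_differentiable :: "(real \<Rightarrow> complex) \<Rightarrow> bool" where
  "twice_differentiable U \<longleftrightarrow>
     (\<forall>x. U differentiable (at x)) \<and> (\<forall>x. D U differentiable (at x))"

definition L_minus :: "(real \<Rightarrow> real) \<Rightarrow> real \<Rightarrow> (real \<Rightarrow> complex) \<Rightarrow> real \<Rightarrow> complex" where
  "L_minus \<phi> \<omega> U = (\<lambda>x. - (1/2) * D (D U) x - of_real ((\<phi> x)\<^sup>2) * U x - of_real \<omega> * U x)"

definition L_plus :: "(real \<Rightarrow> real) \<Rightarrow> real \<Rightarrow> (real \<Rightarrow> complex) \<Rightarrow> real \<Rightarrow> complex" where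
  "L_plus \<phi> \<omega> U = (\<lambda>x. - (1/2) * D (D U) x - 3 * of_real ((\<phi> x)\<^sup>2) * U x - of_real \<omega> * U x)"

definition NLS_lin ::
  "(real \<Rightarrow> real) \<Rightarrow> real \<Rightarrow> (real \<Rightarrow> complex) \<times> (real \<Rightarrow> complex)
    \<Rightarrow> (real \<Rightarrow> complex) \<times> (real \<Rightarrow> complex)" where
  "NLS_lin \<phi> \<omega> W = (L_minus \<phi> \<omega> (snd W), \<lambda>x. - L_plus \<phi> \<omega> (fst W) x)"

text \<open>Eigenfunctions are classical (pointwise) solutions. Twice differentiability is what the
  equation needs to make sense, since \<^const>\<open>vector_derivative\<close> is unspecified where the derivative
  does not exist; for continuous \<open>\<phi>\<close> the equation then gives \<open>C\<^sup>2\<close>. The number \<open>S\<close> is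
  a period of \<open>(U, V)\<close>, not necessarily the least one.\<close>

definition periodic_eigenfunction ::
  "(real \<Rightarrow> real) \<Rightarrow> real \<Rightarrow> real \<Rightarrow> complex \<Rightarrow> (real \<Rightarrow> complex) \<Rightarrow> (real \<Rightarrow> complex) \<Rightarrow> bool" where
  "periodic_eigenfunction \<phi> \<omega> S \<mu> U V \<longleftrightarrow>
     twice_differentiable U \<and> twice_differentiable V \<and>
     (U, V) \<noteq> ((\<lambda>x. 0), (\<lambda>x. 0)) \<and>
     NLS_lin \<phi> \<omega> (U, V) = ((\<lambda>x. \<mu> * U x), (\<lambda>x. \<mu> * V x)) \<and>
     (\<forall>x. U (x + S) = U x \<and> V (x + S) = V x)"

end

theory Submission
  imports Defs
begin

text \<open>
  Stability. \<open>L\<^sub>- \<ge> 0\<close> because \<open>dn > 0\<close> is in its kernel, and \<open>\<lambda> \<noteq> 0\<close> forces \<open>U\<close> to be orthogonal to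
  \<open>dn\<close>. If \<open>L\<^sub>+ \<ge> 0\<close> on the orthogonal complement of \<open>dn\<close>, then pairing the two equations with \<open>V\<close>
  and \<open>U\<close> gives \<open>Re \<lambda> = 0\<close>. The form of \<open>L\<^sub>+\<close> is nonnegative on functions vanishing at the zeros of
  the Lame eigenfunction \<open>sn\<^sup>2 - \<beta>\<close>, whose eigenvalue is nonnegative. Given \<open>U\<close> orthogonal to \<open>dn\<close>,
  adding multiples of \<open>sn cn\<close> (kernel) and of the solution \<open>\<psi>\<close> of \<open>L\<^sub>+ \<psi> = const dn\<close> makes it vanish
  there, and the latter only decreases the form, by the Vakhitov-Kolokolov condition.

  Instability. For spectral parameter \<open>\<i> \<eta>\<close>, \<open>(1 - k')/2 < \<eta> < (1 + k')/2\<close>, where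
  \<open>k'\<^sup>2 = 1 - k\<^sup>2\<close>, the squared eigenfunctions of the Lax pair are Floquet solutions of the eigenvalue
  problem with real \<open>\<lambda> = 2 \<Omega>(\<eta>) > 0\<close> and a multiplier on the unit circle. Its phase depends
  continuously on \<open>\<eta>\<close>, is \<open>0\<close> at the upper end, and is at least \<open>\<pi>\<close> somewhere, so it takes every
  value \<open>2 \<pi> / P\<close> with \<open>P \<ge> 2\<close>.
\<close>

section \<open>Periodic functions and Jacobi's quadratic form identity\<close>

lemma LBINT_has_real_derivative:
  fixes f :: "real \<Rightarrow> real"
  assumes "continuous_on UNIV f"
  shows "((\<lambda>x. LBINT y=0..x. f y) has_real_derivative f x) (at x)"
proof -
  \<comment> \<open>Both \<open>0\<close> and \<open>x\<close> are interior points, so the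
    derivative within the interval is a full derivative.\<close>
  let ?a = "min 0 x - 1" and ?b = "max 0 x + 1"
  have "((\<lambda>u. LBINT y=ereal 0..ereal u. f y) has_vector_derivative f x) (at x within {?a..?b})"
    using assms by (intro interval_integral_FTC2) (auto intro: continuous_on_subset)
  moreover have "at x within {?a..?b} = at x"
    by (rule at_within_Icc_at) auto
  ultimately show ?thesis
    by (simp add: has_real_derivative_iff_has_vector_derivative zero_ereal_def)
qed

lemma has_integral_real_deriv:
  fixes G g :: "real \<Rightarrow> real"
  assumes "\<And>x. (G has_real_derivative g x) (at x)" and "a \<le> b"
  shows "(g has_integral G b - G a) {a..b}"
  using assms by (intro fundamental_theorem_of_calculus)
    (auto simp: has_real_derivative_iff_has_vector_derivative[symmetric] intro: DERIV_subset)

lemma has_integral_deriv_periodic: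
  fixes G g :: "real \<Rightarrow> real"
  assumes "\<And>x. (G has_real_derivative g x) (at x)" and "\<And>x. G (x + T) = G x" and "0 \<le> T"
  shows "(g has_integral 0) {y..y + T}"
proof -
  have "(g has_integral G (y + T) - G y) {y..y + T}"
    using assms by (intro has_integral_real_deriv) auto
  then show ?thesis using assms(2) by simp
qed

lemma antiderivative_continuous_real:
  fixes f :: "real \<Rightarrow> real"
  assumes "continuous_on UNIV f"
  obtains F where "\<And>x. (F has_real_derivative f x) (at x)"
  using LBINT_has_real_derivative[OF assms] by blast

lemma periodic_deriv:
  fixes f :: "real \<Rightarrow> real"
  assumes "\<And>x. (f has_real_derivative f' x) (at x)" and "\<And>x. f (x + p) = f x"
  shows "f' (x + p) = f' x"
proof -
  have "((\<lambda>x. f (x + p)) has_real_derivative f' (x + p) * 1) (at x)"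
    by (rule DERIV_chain2[OF assms(1)]) (auto intro!: derivative_eq_intros)
  then show ?thesis
    using assms by (simp add: DERIV_unique[OF _ assms(1)[of x]])
qed

lemma periodic_eq_0:
  fixes f :: "real \<Rightarrow> real"
  assumes per: "\<And>x. f (x + p) = f x" and zero: "\<And>x. x \<in> {y..y + p} \<Longrightarrow> f x = 0" and "0 < p"
  shows "f x = 0"
proof -
  have nat: "f (z + real n * p) = f z" for z n
  proof (induction n)
    case (Suc n)
    have "f (z + real (Suc n) * p) = f ((z + real n * p) + p)" by (simp add: algebra_simps)
    then show ?case using Suc per by simp
  qed simp
  have int: "f (z + of_int n * p) = f z" for z n
  proof (cases "0 \<le> n")
    case True
    then show ?thesis using nat[of z "nat n"] by simp
  next
    case False
    then show ?thesis using nat[of "z + of_int n * p" "nat (- n)"] by (simp add: algebra_simps)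
  qed
  define n where "n = \<lfloor>(x - y) / p\<rfloor>"
  have "of_int n \<le> (x - y) / p" "(x - y) / p < of_int n + 1"
    by (auto simp: n_def)
  then have "of_int n * p \<le> x - y" "x - y \<le> (of_int n + 1) * p"
    using \<open>0 < p\<close> by (simp_all add: field_simps)
  then have "x + of_int (- n) * p \<in> {y..y + p}"
    by (auto simp: algebra_simps)
  then show ?thesis using zero int[of x "- n"] by metis
qed

text \<open>Dividing both terms by \<open>x - a\<close> turns them into difference quotients. This
  controls the singular factor \<open>f / h\<close> at a simple zero of \<open>h\<close>.\<close>

lemma tendsto_ratio_at_zero:
  fixes f h :: "real \<Rightarrow> real"
  assumes "(f has_real_derivative f') (at a)" "(h has_real_derivative h') (at a)"
    and "f a = 0" "h a = 0" "h' \<noteq> 0"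
  shows "((\<lambda>x. f x / h x) \<longlongrightarrow> f' / h') (at a)"
proof -
  have "((\<lambda>x. (f x / (x - a)) / (h x / (x - a))) \<longlongrightarrow> f' / h') (at a)"
    using assms by (intro tendsto_divide) (simp_all add: has_field_derivative_iff)
  moreover have "\<forall>\<^sub>F x in at a. (f x / (x - a)) / (h x / (x - a)) = f x / h x"
    by (intro eventually_mono[OF eventually_neq_at_within[of a]]) auto
  ultimately show ?thesis by (rule Lim_transform_eventually)
qed

text \<open>Jacobi's argument: on an interval between consecutive zeros of \<open>h\<close>, write
  \<open>f'\<^sup>2 - q f\<^sup>2 = (f' - (h'/h) f)\<^sup>2 + m f\<^sup>2 + ((h'/h) f\<^sup>2)'\<close>.
  The singular boundary term vanishes because \<open>f\<close> does.\<close>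

lemma jacobi_quadratic_form:
  fixes f f1 f2 h h1 h2 q :: "real \<Rightarrow> real"
  assumes "a < b" "0 \<le> m"
    and f: "\<And>x. (f has_real_derivative f1 x) (at x)" "\<And>x. (f1 has_real_derivative f2 x) (at x)"
    and h: "\<And>x. (h has_real_derivative h1 x) (at x)" "\<And>x. (h1 has_real_derivative h2 x) (at x)"
    and cont: "continuous_on UNIV f2" "continuous_on UNIV q"
    and f0: "f a = 0" "f b = 0" and h0: "h a = 0" "h b = 0" "h1 a \<noteq> 0" "h1 b \<noteq> 0"
    and nz: "\<And>x. a < x \<Longrightarrow> x < b \<Longrightarrow> h x \<noteq> 0"
    and h2: "\<And>x. h2 x = - (q x + m) * h x"
  shows "integral {a..b} (\<lambda>x. f x * (f2 x + q x * f x)) \<le> 0"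
proof -
  define g where "g = (\<lambda>x. f x * (f2 x + q x * f x))"
  have cf: "continuous_on UNIV f" using f(1)
    by (meson DERIV_isCont continuous_at_imp_continuous_on)
  have "continuous_on UNIV g"
    unfolding g_def by (intro continuous_intros cont cf)
  then obtain G where G: "\<And>x. (G has_real_derivative g x) (at x)"
    using antiderivative_continuous_real by blast
  \<comment> \<open>At the end points division by zero gives \<open>B\<close> the value 0, which is
    also its limit because \<open>f\<close> vanishes there and the zero of \<open>h\<close> is
    simple.\<close>
  define B where "B = (\<lambda>x. (h1 x / h x) * (f x)\<^sup>2)"
  \<comment> \<open>\<open>H\<close> gathers all exact derivatives: its slope is the nonnegative
    part of Jacobi's identity, and its end values are \<open>- G a\<close> and
    \<open>- G b\<close>.\<close>
  define H where "H = (\<lambda>x. f x * f1 x - B x - G x)"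
  have B_end: "isCont B c" if "f c = 0" "h c = 0" "h1 c \<noteq> 0" for c
  proof -
    have "((\<lambda>x. h1 x * f x * (f x / h x)) \<longlongrightarrow> h1 c * f c * (f1 c / h1 c)) (at c)"
      using that f h by (intro tendsto_mult tendsto_ratio_at_zero isContD DERIV_isCont) auto
    moreover have "(\<lambda>x. h1 x * f x * (f x / h x)) = B"
      by (auto simp: B_def power2_eq_square)
    ultimately show ?thesis
      using that by (simp add: isCont_def B_def)
  qed
  have dH: "(H has_real_derivative (f1 x - h1 x / h x * f x)\<^sup>2 + m * (f x)\<^sup>2) (at x)"
    if "a < x" "x < b" for x
  proof -
    note [simp] = nz[OF that]
    have "h2 x / h x = - (q x + m)"
      by (simp add: h2)
    then have ratio: "(h2 x * h x - h1 x * h1 x) / (h x * h x) = - (q x + m) - (h1 x / h x)\<^sup>2"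
      by (simp add: diff_divide_distrib power2_eq_square)
    have "(H has_real_derivative f1 x * f1 x + f x * f2 x
        - ((h2 x * h x - h1 x * h1 x) / (h x * h x) * (f x)\<^sup>2 + h1 x / h x * (2 * f x * f1 x)) - g x) (at x)"
      unfolding H_def B_def
      by (auto intro!: derivative_eq_intros f h G) (simp add: field_simps)
    also have "f1 x * f1 x + f x * f2 x
        - ((h2 x * h x - h1 x * h1 x) / (h x * h x) * (f x)\<^sup>2 + h1 x / h x * (2 * f x * f1 x)) - g x
        = (f1 x - h1 x / h x * f x)\<^sup>2 + m * (f x)\<^sup>2"
      unfolding ratio g_def by (simp add: algebra_simps power2_eq_square)
    finally show ?thesis .
  qed
  have "H a \<le> H b"
  proof (rule DERIV_nonneg_imp_increasing_open[where f=H])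
    show "\<exists>y. (H has_real_derivative y) (at x) \<and> 0 \<le> y" if "a < x" "x < b" for x
      using dH[OF that] \<open>0 \<le> m\<close> by force
    have "isCont H x" if x: "x \<in> {a..b}" for x
    proof (cases "x = a \<or> x = b")
      case True
      then have "isCont B x" using B_end f0 h0 by auto
      then show ?thesis
        unfolding H_def using DERIV_isCont[OF f(1)] DERIV_isCont[OF f(2)] DERIV_isCont[OF G]
        by (intro continuous_intros)
    next
      case False
      then show ?thesis using dH[of x] x by (auto intro: DERIV_isCont)
    qed
    then show "continuous_on {a..b} H" by (auto intro: continuous_at_imp_continuous_on)
  qed (use \<open>a < b\<close> in simp)
  then have "G b - G a \<le> 0"
    using f0 by (simp add: H_def B_def)
  moreover have "(g has_integral G b - G a) {a..b}"
    using \<open>a < b\<close> by (intro has_integral_real_deriv[OF G]) simp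
  ultimately show ?thesis by (simp add: integral_unique flip: g_def)
qed

text \<open>A monotone \<open>G\<close> that does not grow is constant, so \<open>g\<close> vanishes
  inside, and by continuity at the ends. It serves to make a mean value inequality strict.\<close>

lemma nonneg_deriv_zero:
  fixes G g :: "real \<Rightarrow> real"
  assumes G: "\<And>x. (G has_real_derivative g x) (at x)" and cont: "continuous_on UNIV g"
    and nonneg: "\<And>x. 0 \<le> g x" and le: "G b \<le> G a" and "a < b" and x: "x \<in> {a..b}"
  shows "g x = 0"
proof -
  have mono: "G u \<le> G v" if "u \<le> v" for u v
    by (rule DERIV_nonneg_imp_nondecreasing[OF that]) (use G nonneg in blast)
  have const: "G y = G a" if "y \<in> {a..b}" for y
    using that mono[of a y] mono[of y b] le by auto
  have zero: "g y = 0" if y: "y \<in> {a<..<b}" for y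
  proof -
    have "G y = G z" if "\<bar>y - z\<bar> < min (y - a) (b - y)" for z
    proof -
      have "z \<in> {a..b}" "y \<in> {a..b}" using that y by (auto simp: abs_if split: if_splits)
      then show ?thesis using const by metis
    qed
    moreover have "0 < min (y - a) (b - y)" using y by simp
    ultimately show ?thesis using DERIV_local_const[OF G, of "min (y - a) (b - y)" y] by blast
  qed
  have "g ` closure {a<..<b} \<subseteq> {0}"
    by (rule image_closure_subset) (use cont zero in \<open>auto intro: continuous_on_subset\<close>)
  then show ?thesis using x \<open>a < b\<close> by (simp add: image_subset_iff)
qed

section \<open>Pointwise form of the eigenvalue equations\<close>

lemma
  assumes "f differentiable (at x)"
  shows has_real_derivative_Re: "((\<lambda>x. Re (f x)) has_real_derivative Re (vector_derivative f (at x))) (at x)"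
    and has_real_derivative_Im: "((\<lambda>x. Im (f x)) has_real_derivative Im (vector_derivative f (at x))) (at x)"
  using assms bounded_linear.has_vector_derivative[OF bounded_linear_Re]
    bounded_linear.has_vector_derivative[OF bounded_linear_Im]
  by (auto simp: has_real_derivative_iff_has_vector_derivative vector_derivative_works)

lemma periodic_eigenfunction_deriv2:
  assumes "periodic_eigenfunction \<phi> \<omega> S \<mu> U V"
  shows "D (D U) x = 2 * \<mu> * V x - 2 * of_real (3 * (\<phi> x)\<^sup>2 + \<omega>) * U x"
    and "D (D V) x = - 2 * \<mu> * U x - 2 * of_real ((\<phi> x)\<^sup>2 + \<omega>) * V x"
proof -
  have "L_minus \<phi> \<omega> V x = \<mu> * U x" "- L_plus \<phi> \<omega> U x = \<mu> * V x"
    using assms by (auto simp: periodic_eigenfunction_def NLS_lin_def fun_eq_iff)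
  then show "D (D U) x = 2 * \<mu> * V x - 2 * of_real (3 * (\<phi> x)\<^sup>2 + \<omega>) * U x"
    and "D (D V) x = - 2 * \<mu> * U x - 2 * of_real ((\<phi> x)\<^sup>2 + \<omega>) * V x"
    unfolding L_minus_def L_plus_def of_real_add of_real_mult of_real_numeral by algebra+
qed

section \<open>Jacobi elliptic functions\<close>

locale elliptic_modulus =
  fixes k :: real
  assumes k_nonneg: "0 \<le> k" and k_less_1: "k < 1"
begin

text \<open>The complementary modulus, which is the minimum of \<open>dn\<close>.\<close>

definition kc :: real where "kc = sqrt (1 - k\<^sup>2)"
definition w :: real where "w = (1/2) * (k\<^sup>2 - 2)"
definition T :: real where "T = 2 * ellK k"
definition sn :: "real \<Rightarrow> real" where "sn x = sin (jacobi_am x k)"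
definition cn :: "real \<Rightarrow> real" where "cn x = cos (jacobi_am x k)"
definition dn :: "real \<Rightarrow> real" where "dn x = jacobi_dn x k"
definition dn' :: "real \<Rightarrow> real" where "dn' x = - k\<^sup>2 * sn x * cn x"

lemma k_sq_less_1: "k\<^sup>2 < 1"
  using k_nonneg k_less_1 by (simp add: power_less_one_iff abs_square_less_1)

lemma kc_pos: "0 < kc" and kc_le_1: "kc \<le> 1" and kc_sq: "kc\<^sup>2 = 1 - k\<^sup>2"
  using k_sq_less_1 by (auto simp: kc_def)

lemma radicand_pos: "0 < 1 - k\<^sup>2 * (sin t)\<^sup>2"
proof -
  have "k\<^sup>2 * (sin t)\<^sup>2 \<le> k\<^sup>2 * 1"
    by (intro mult_left_mono) (auto simp: abs_square_le_1)
  then show ?thesis using k_sq_less_1 by simp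
qed

lemma ellF_deriv: "(ellF k has_real_derivative 1 / sqrt (1 - k\<^sup>2 * (sin t)\<^sup>2)) (at t)"
proof -
  have "continuous_on UNIV (\<lambda>y. (1 - k\<^sup>2 * (sin y)\<^sup>2) powr (-1/2))"
    using radicand_pos by (intro continuous_intros) (auto simp: less_le)
  from LBINT_has_real_derivative[OF this]
  have "(ellF k has_real_derivative (1 - k\<^sup>2 * (sin t)\<^sup>2) powr (-1/2)) (at t)"
    unfolding ellF_def by (simp add: fun_eq_iff[symmetric])
  moreover have "(1 - k\<^sup>2 * (sin t)\<^sup>2) powr (-1/2) = 1 / sqrt (1 - k\<^sup>2 * (sin t)\<^sup>2)"
    using radicand_pos[of t] by (simp add: powr_minus powr_half_sqrt field_simps)
  ultimately show ?thesis by simp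
qed

lemma ellF_0: "ellF k 0 = 0"
  by (simp add: ellF_def flip: zero_ereal_def)

text \<open>The integrand is at least 1. This growth yields injectivity and, with the intermediate
  value theorem, surjectivity.\<close>

lemma ellF_increase: "y - x \<le> ellF k y - ellF k x" if "x \<le> y"
proof -
  have "ellF k x - x \<le> ellF k y - y"
  proof (rule DERIV_nonneg_imp_nondecreasing[OF that])
    fix t
    have "1 \<le> 1 / sqrt (1 - k\<^sup>2 * (sin t)\<^sup>2)"
      using radicand_pos[of t] by (simp add: field_simps)
    moreover have "((\<lambda>t. ellF k t - t) has_real_derivative 1 / sqrt (1 - k\<^sup>2 * (sin t)\<^sup>2) - 1) (at t)"
      by (auto intro!: derivative_eq_intros ellF_deriv)
    ultimately show "\<exists>d. ((\<lambda>t. ellF k t - t) has_real_derivative d) (at t) \<and> 0 \<le> d" by force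
  qed
  then show ?thesis by simp
qed

lemma ellF_strict_mono: "strict_mono (ellF k)"
  using ellF_increase by (intro strict_monoI) (smt (verit, best))

lemma continuous_ellF: "continuous_on A (ellF k)"
  using ellF_deriv by (meson DERIV_isCont continuous_at_imp_continuous_on)

lemma ellF_surj: "surj (ellF k)"
proof -
  have "\<exists>t. ellF k t = x" for x
  proof -
    have "ellF k (- \<bar>x\<bar>) \<le> x" "x \<le> ellF k \<bar>x\<bar>"
      using ellF_increase[of "- \<bar>x\<bar>" 0] ellF_increase[of 0 "\<bar>x\<bar>"] ellF_0 by auto
    then show ?thesis
      using IVT'[of "ellF k" "- \<bar>x\<bar>" x "\<bar>x\<bar>"] continuous_ellF by auto
  qed
  then show ?thesis by (metis surj_def)
qed

lemma ellF_am: "ellF k (jacobi_am x k) = x"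
  using ellF_surj by (simp add: jacobi_am_def surj_f_inv_f)

lemma am_ellF: "jacobi_am (ellF k t) k = t"
  using ellF_strict_mono by (simp add: jacobi_am_def strict_mono_imp_inj_on)

lemma am_strict_mono: "jacobi_am x k < jacobi_am y k" if "x < y"
  using that ellF_strict_mono by (metis ellF_am strict_mono_less)

lemma dn_eq: "dn x = sqrt (1 - k\<^sup>2 * (sn x)\<^sup>2)"
  by (simp add: dn_def sn_def jacobi_dn_def)

lemma am_deriv: "((\<lambda>x. jacobi_am x k) has_real_derivative dn x) (at x)"
proof -
  have "isCont (\<lambda>x. jacobi_am x k) (ellF k (jacobi_am x k))"
    by (rule isCont_inverse_function[where d=1])
      (auto simp: am_ellF intro: DERIV_isCont ellF_deriv)
  then have "DERIV (\<lambda>x. jacobi_am x k) x :> inverse (1 / dn x)"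
    using ellF_deriv radicand_pos[of "jacobi_am x k"]
    by (intro DERIV_inverse_function[where f="ellF k" and a="x - 1" and b="x + 1"])
      (auto simp: ellF_am dn_eq sn_def)
  then show ?thesis by simp
qed

lemma ellF_minus: "ellF k (- t) = - ellF k t"
proof -
  have "ellF k (- t) + ellF k t = ellF k (- 0) + ellF k 0"
  proof (rule DERIV_isconst_all[where f="\<lambda>t. ellF k (- t) + ellF k t"])
    have m: "((\<lambda>t. ellF k (- t)) has_real_derivative 1 / sqrt (1 - k\<^sup>2 * (sin (- t))\<^sup>2) * - 1) (at t)" for t
      by (rule DERIV_chain2[OF ellF_deriv]) (auto intro!: derivative_eq_intros)
    show "\<forall>t. ((\<lambda>t. ellF k (- t) + ellF k t) has_real_derivative 0) (at t)"
      using DERIV_add[OF m ellF_deriv] by simp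
  qed
  then show ?thesis using ellF_0 by simp
qed

lemma ellF_add_pi: "ellF k (t + pi) = ellF k t + T"
proof -
  \<comment> \<open>The integrand has period pi, so the difference is constant; at
    \<open>- (pi/2)\<close> oddness makes it twice the complete integral.\<close>
  have "ellF k (t + pi) - ellF k t = ellF k (- (pi/2) + pi) - ellF k (- (pi/2))"
  proof (rule DERIV_isconst_all[where f="\<lambda>t. ellF k (t + pi) - ellF k t"])
    have m: "((\<lambda>t. ellF k (t + pi)) has_real_derivative 1 / sqrt (1 - k\<^sup>2 * (sin (t + pi))\<^sup>2) * 1) (at t)" for t
      by (rule DERIV_chain2[OF ellF_deriv]) (auto intro!: derivative_eq_intros)
    show "\<forall>t. ((\<lambda>t. ellF k (t + pi) - ellF k t) has_real_derivative 0) (at t)"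
      using DERIV_diff[OF m ellF_deriv] by simp
  qed
  then show ?thesis by (simp add: ellF_minus T_def ellK_def)
qed

lemma am_add_T: "jacobi_am (x + T) k = jacobi_am x k + pi"
  by (metis am_ellF ellF_add_pi ellF_am)

lemma T_pos: "0 < T"
  using ellF_add_pi[of 0] ellF_increase[of 0 pi] ellF_0 pi_gt_zero by (simp del: pi_gt_zero)

lemma sn_add_T: "sn (x + T) = - sn x" and cn_add_T: "cn (x + T) = - cn x"
  and dn_add_T: "dn (x + T) = dn x"
  by (simp_all add: dn_eq sn_def cn_def am_add_T)

lemma dn'_add_T: "dn' (x + T) = dn' x"
  by (simp add: dn'_def sn_add_T cn_add_T)

lemma dn_pos: "0 < dn x"
  using radicand_pos by (simp add: dn_eq sn_def)

lemma dn_sq: "(dn x)\<^sup>2 = 1 - k\<^sup>2 * (sn x)\<^sup>2"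
  using radicand_pos[of "jacobi_am x k"] by (simp add: dn_eq sn_def)

lemma cn_sq: "(cn x)\<^sup>2 = 1 - (sn x)\<^sup>2"
  by (simp add: sn_def cn_def cos_squared_eq)

section \<open>Derivatives of the elliptic functions and the profile equation\<close>

lemma sn_deriv: "(sn has_real_derivative cn x * dn x) (at x)"
  unfolding sn_def[abs_def] cn_def by (auto intro!: derivative_eq_intros am_deriv)

lemma cn_deriv: "(cn has_real_derivative - sn x * dn x) (at x)"
  unfolding cn_def[abs_def] sn_def by (auto intro!: derivative_eq_intros am_deriv)

lemma dn_deriv: "(dn has_real_derivative dn' x) (at x)"
proof -
  have "dn = (\<lambda>x. sqrt (1 - k\<^sup>2 * (sn x)\<^sup>2))" by (simp add: fun_eq_iff dn_eq)
  moreover have "((\<lambda>x. sqrt (1 - k\<^sup>2 * (sn x)\<^sup>2)) has_real_derivative dn' x) (at x)"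
    using radicand_pos[of "jacobi_am x k"] dn_pos[of x]
    by (auto intro!: derivative_eq_intros sn_deriv simp: sn_def[symmetric] dn'_def)
      (simp add: dn_eq[symmetric] field_simps)
  ultimately show ?thesis by simp
qed

text \<open>The first integral of the stationary equation; it eliminates the square of
  \<open>dn'\<close> from later identities.\<close>

lemma dn'_sq: "(dn' x)\<^sup>2 = - ((dn x)^4) - 2 * w * (dn x)\<^sup>2 - kc\<^sup>2"
proof -
  have "(dn' x)\<^sup>2 = k^4 * (sn x)\<^sup>2 * (1 - (sn x)\<^sup>2)"
    by (simp add: dn'_def power_mult_distrib cn_sq)
  also have "\<dots> = - ((1 - k\<^sup>2 * (sn x)\<^sup>2)\<^sup>2) - 2 * w * (1 - k\<^sup>2 * (sn x)\<^sup>2) - kc\<^sup>2"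
    unfolding kc_sq w_def by (simp add: field_simps power2_eq_square power4_eq_xxxx)
  finally show ?thesis by (simp flip: dn_sq)
qed

text \<open>This is the stationary NLS equation for the profile, in other words \<open>dn\<close>
  lies in the kernel of \<open>L_minus\<close>.\<close>

lemma dn'_deriv: "(dn' has_real_derivative - 2 * (dn x)^3 - 2 * w * dn x) (at x)"
proof -
  have "(dn' has_real_derivative - k\<^sup>2 * ((cn x)\<^sup>2 - (sn x)\<^sup>2) * dn x) (at x)"
    unfolding dn'_def[abs_def]
    by (auto intro!: derivative_eq_intros sn_deriv cn_deriv simp: algebra_simps power2_eq_square)
  also have "- k\<^sup>2 * ((cn x)\<^sup>2 - (sn x)\<^sup>2) * dn x = (- 2 * (dn x)\<^sup>2 - 2 * w) * dn x"
    unfolding cn_sq dn_sq w_def by algebra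
  also have "\<dots> = - 2 * (dn x)^3 - 2 * w * dn x"
    by (simp add: algebra_simps power2_eq_square power3_eq_cube)
  finally show ?thesis .
qed

lemmas dn_derivs [derivative_intros] = sn_deriv[THEN DERIV_chain2] cn_deriv[THEN DERIV_chain2]
  dn_deriv[THEN DERIV_chain2] dn'_deriv[THEN DERIV_chain2]
lemma continuous_dn: "continuous_on A dn" and continuous_dn': "continuous_on A dn'"
  and continuous_sn: "continuous_on A sn" and continuous_cn: "continuous_on A cn"
  using dn_deriv dn'_deriv sn_deriv cn_deriv
  by (meson DERIV_isCont continuous_at_imp_continuous_on)+


section \<open>Co-periodic stability\<close>

text \<open>The potential is scaled so that \<open>f2 + q * f\<close> is -2 times
  \<open>L_plus\<close> applied to \<open>f\<close>; the forms below therefore carry the opposite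
  sign.\<close>

definition q :: "real \<Rightarrow> real" where "q x = 6 * (dn x)\<^sup>2 + 2 * w"

text \<open>The derivatives are arguments, so that second-order identities become algebra in three
  given functions.\<close>

definition C2per :: "(real \<Rightarrow> real) \<Rightarrow> (real \<Rightarrow> real) \<Rightarrow> (real \<Rightarrow> real) \<Rightarrow> bool" where
  "C2per f f1 f2 \<longleftrightarrow> (\<forall>x. (f has_real_derivative f1 x) (at x)) \<and>
     (\<forall>x. (f1 has_real_derivative f2 x) (at x)) \<and> continuous_on UNIV f2 \<and> (\<forall>x. f (x + T) = f x)"

lemma C2perD:
  assumes "C2per f f1 f2"
  shows "(f has_real_derivative f1 x) (at x)" "(f1 has_real_derivative f2 x) (at x)"
    "f (x + T) = f x" "f1 (x + T) = f1 x" "f2 (x + T) = f2 x"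
    "continuous_on A f" "continuous_on A f1" "continuous_on A f2"
proof -
  note d = assms[unfolded C2per_def]
  show d1: "(f has_real_derivative f1 x) (at x)" and d2: "(f1 has_real_derivative f2 x) (at x)" for x
    using d by auto
  show per: "f (x + T) = f x" for x using d by simp
  show per1: "f1 (x + T) = f1 x" for x
    using periodic_deriv[OF d1 per] .
  show "f2 (x + T) = f2 x"
    using periodic_deriv[OF d2 per1] .
  show "continuous_on A f" "continuous_on A f1" "continuous_on A f2"
    using d1 d2 d by (auto intro: continuous_at_imp_continuous_on DERIV_isCont continuous_on_subset)
qed

section \<open>Self-adjointness and explicit eigenfunctions on the period\<close>

lemma continuous_q: "continuous_on A q"
  unfolding q_def[abs_def] by (intro continuous_intros continuous_dn)

lemma C2per_lincomb:
  assumes "C2per f f1 f2" "C2per g g1 g2" "C2per h h1 h2"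
  shows "C2per (\<lambda>x. f x + c * g x + d * h x) (\<lambda>x. f1 x + c * g1 x + d * h1 x)
    (\<lambda>x. f2 x + c * g2 x + d * h2 x)"
  unfolding C2per_def
proof (intro conjI allI)
  note f = C2perD[OF assms(1)] and g = C2perD[OF assms(2)] and h = C2perD[OF assms(3)]
  show "((\<lambda>x. f x + c * g x + d * h x) has_real_derivative f1 x + c * g1 x + d * h1 x) (at x)" for x
    by (intro DERIV_add DERIV_cmult f(1) g(1) h(1))
  show "((\<lambda>x. f1 x + c * g1 x + d * h1 x) has_real_derivative f2 x + c * g2 x + d * h2 x) (at x)" for x
    by (intro DERIV_add DERIV_cmult f(2) g(2) h(2))
  show "continuous_on UNIV (\<lambda>x. f2 x + c * g2 x + d * h2 x)"
    by (intro continuous_intros f(8) g(8) h(8))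
  show "f (x + T) + c * g (x + T) + d * h (x + T) = f x + c * g x + d * h x" for x
    by (simp only: f(3) g(3) h(3))
qed

text \<open>The integrand is the derivative of the periodic Wronskian. Potential terms cancel in it,
  so this is the symmetry of both operators.\<close>

lemma green:
  assumes "C2per f f1 f2" "C2per g g1 g2"
  shows "((\<lambda>x. f x * g2 x - g x * f2 x) has_integral 0) {y..y + T}"
proof (rule has_integral_deriv_periodic)
  show "((\<lambda>x. f x * g1 x - g x * f1 x) has_real_derivative f x * g2 x - g x * f2 x) (at x)" for x
    by (auto intro!: derivative_eq_intros C2perD(1-2)[OF assms(1)] C2perD(1-2)[OF assms(2)]
        simp: algebra_simps)
qed (use T_pos C2perD(3,4)[OF assms(1)] C2perD(3,4)[OF assms(2)] in auto)

lemma C2per_dn: "C2per dn dn' (\<lambda>x. - 2 * (dn x)^3 - 2 * w * dn x)"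
  unfolding C2per_def
  using dn_deriv dn'_deriv by (auto intro!: continuous_intros continuous_dn simp: dn_add_T)

text \<open>For positive \<open>k\<close> this is the translation mode, a multiple of
  \<open>dn'\<close>. Without the factor \<open>k^2\<close> it stays a nonzero kernel element at
  \<open>k = 0\<close>.\<close>

lemma C2per_sn_cn: "C2per (\<lambda>x. sn x * cn x) (\<lambda>x. ((cn x)\<^sup>2 - (sn x)\<^sup>2) * dn x)
  (\<lambda>x. - q x * (sn x * cn x))"
  unfolding C2per_def
proof (intro conjI allI)
  fix x
  show "((\<lambda>x. sn x * cn x) has_real_derivative ((cn x)\<^sup>2 - (sn x)\<^sup>2) * dn x) (at x)"
    by (auto intro!: derivative_eq_intros sn_deriv cn_deriv simp: algebra_simps power2_eq_square)
  have "((\<lambda>x. ((cn x)\<^sup>2 - (sn x)\<^sup>2) * dn x) has_real_derivative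
      - 4 * (dn x)\<^sup>2 * (sn x * cn x) - k\<^sup>2 * ((cn x)\<^sup>2 - (sn x)\<^sup>2) * (sn x * cn x)) (at x)"
    by (auto intro!: derivative_eq_intros sn_deriv cn_deriv dn_deriv
        simp: dn'_def algebra_simps power2_eq_square)
  moreover have "- 4 * (dn x)\<^sup>2 * (sn x * cn x) - k\<^sup>2 * ((cn x)\<^sup>2 - (sn x)\<^sup>2) * (sn x * cn x)
      = - q x * (sn x * cn x)"
    unfolding q_def dn_sq cn_sq w_def by algebra
  ultimately show "((\<lambda>x. ((cn x)\<^sup>2 - (sn x)\<^sup>2) * dn x) has_real_derivative - q x * (sn x * cn x)) (at x)"
    by simp
qed (auto intro!: continuous_intros continuous_q continuous_sn continuous_cn simp: sn_add_T cn_add_T)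

text \<open>Inserting sn^2 - \<beta> into the Lame equation leaves a constant remainder, quadratic
  in \<beta>. A root not above 1/2 makes the eigenvalue \<open>m / 2\<close> of
  \<open>L_plus\<close> nonnegative.\<close>

lemma sn_sq_eigenfunction:
  obtains \<beta> m where "0 < \<beta>" "\<beta> \<le> 1 / 2" "0 \<le> m"
    "\<And>x. ((\<lambda>x. (sn x)\<^sup>2 - \<beta>) has_real_derivative 2 * sn x * cn x * dn x) (at x)"
    "\<And>x. ((\<lambda>x. 2 * sn x * cn x * dn x) has_real_derivative - (q x + m) * ((sn x)\<^sup>2 - \<beta>)) (at x)"
proof -
  \<comment> \<open>The quadratic is 1 at 0 and -k^2/4 at 1/2.\<close>
  have "\<exists>\<beta>. 0 \<le> \<beta> \<and> \<beta> \<le> 1 / 2 \<and> 3 * k\<^sup>2 * \<beta>\<^sup>2 - (2 + 2 * k\<^sup>2) * \<beta> + 1 = 0"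
    by (rule IVT2') (auto intro!: continuous_intros simp: field_simps power2_eq_square)
  then obtain \<beta> where \<beta>: "0 \<le> \<beta>" "\<beta> \<le> 1 / 2" and root: "3 * k\<^sup>2 * \<beta>\<^sup>2 - (2 + 2 * k\<^sup>2) * \<beta> + 1 = 0"
    by blast
  define m where "m = 3 * k\<^sup>2 * (1 - 2 * \<beta>)"
  show ?thesis
  proof
    show "0 < \<beta>" using \<beta> root by (cases "\<beta> = 0") auto
    show "\<beta> \<le> 1 / 2" "0 \<le> m" using \<beta> by (auto simp: m_def)
    show "((\<lambda>x. (sn x)\<^sup>2 - \<beta>) has_real_derivative 2 * sn x * cn x * dn x) (at x)" for x
      by (auto intro!: derivative_eq_intros sn_deriv)
    fix x
    have "((\<lambda>x. 2 * sn x * cn x * dn x) has_real_derivative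
        2 * (cn x)\<^sup>2 * (dn x)\<^sup>2 - 2 * (sn x)\<^sup>2 * (dn x)\<^sup>2 - 2 * k\<^sup>2 * (sn x)\<^sup>2 * (cn x)\<^sup>2) (at x)"
      by (auto intro!: derivative_eq_intros sn_deriv cn_deriv dn_deriv
        simp: dn'_def algebra_simps power2_eq_square)
    moreover
    have "2 * (cn x)\<^sup>2 * (dn x)\<^sup>2 - 2 * (sn x)\<^sup>2 * (dn x)\<^sup>2 - 2 * k\<^sup>2 * (sn x)\<^sup>2 * (cn x)\<^sup>2
       + (q x + m) * ((sn x)\<^sup>2 - \<beta>) = 2 * (3 * k\<^sup>2 * \<beta>\<^sup>2 - (2 + 2 * k\<^sup>2) * \<beta> + 1)"
      unfolding q_def m_def dn_sq cn_sq w_def by algebra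
    then have "2 * (cn x)\<^sup>2 * (dn x)\<^sup>2 - 2 * (sn x)\<^sup>2 * (dn x)\<^sup>2 - 2 * k\<^sup>2 * (sn x)\<^sup>2 * (cn x)\<^sup>2
       = - (q x + m) * ((sn x)\<^sup>2 - \<beta>)"
      unfolding root minus_mult_left[symmetric] by linarith
    ultimately show "((\<lambda>x. 2 * sn x * cn x * dn x) has_real_derivative - (q x + m) * ((sn x)\<^sup>2 - \<beta>)) (at x)"
      by (simp only:)
  qed
qed


section \<open>The Vakhitov-Kolokolov condition\<close>

lemma kc_less_1: "0 < k \<Longrightarrow> kc < 1"
  by (simp add: kc_def)

lemma w_eq: "w = - (1 + kc\<^sup>2) / 2"
  by (simp add: w_def kc_sq)

text \<open>\<open>\<psi>\<close> solves \<open>L\<^sub>+ \<psi> = (\<alpha>/2) dn\<close>, and \<open>\<alpha> v < 0\<close> is the Vakhitov-Kolokolov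
  condition. For \<open>k > 0\<close>, \<open>\<psi>\<close> combines the scaling derivative \<open>dn + x dn'\<close> with
  \<open>E dn' - dn\<^sup>3 - 2 \<omega> dn\<close>, where \<open>E' = dn\<^sup>2\<close>, so that the secular terms cancel
  (\<open>e\<close> is the mean of \<open>dn\<^sup>2\<close>). The condition then reads \<open>e > kc\<close>, and
  \<open>dn\<^sup>2\<close> and \<open>kc\<^sup>2 / dn\<^sup>2\<close> have the same mean.\<close>

lemma vakhitov_kolokolov:
  obtains \<psi> \<psi>1 \<psi>2 \<alpha> v where "C2per \<psi> \<psi>1 \<psi>2" "\<And>x. \<psi>2 x + q x * \<psi> x = - \<alpha> * dn x"
    "\<And>y. ((\<lambda>x. \<psi> x * dn x) has_integral v) {y..y + T}" "\<alpha> * v < 0"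
proof (cases "k = 0")
  case True
  then have dn: "dn x = 1" and w: "w = -1" for x unfolding dn_eq w_def by simp_all
  show ?thesis
  \<comment> \<open>For constant \<open>dn\<close> the potential \<open>q\<close> is 4, so the
    constant 1 is a solution with \<alpha> = -4.\<close>
  proof (rule that[of "\<lambda>_. 1" "\<lambda>_. 0" "\<lambda>_. 0" "-4" T])
    show "((\<lambda>x. 1 * dn x) has_integral T) {y..y + T}" for y
      using has_integral_const_real[of "1::real" y "y + T"] T_pos by (simp add: dn)
  qed (use T_pos in \<open>auto simp: C2per_def q_def dn w\<close>)
next
  case False
  then have "0 < k" using k_nonneg by simp
  have "continuous_on UNIV (\<lambda>x. (dn x)\<^sup>2)" by (intro continuous_intros continuous_dn)
  then obtain E where E: "\<And>x. (E has_real_derivative (dn x)\<^sup>2) (at x)"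
    using antiderivative_continuous_real by blast
  define e where "e = (E T - E 0) / T"
  \<comment> \<open>Up to an additive constant this is the Jacobi zeta function, the periodic part
    of \<open>E\<close>.\<close>
  define Z where "Z = (\<lambda>x. E x - e * x)"
  have Z: "(Z has_real_derivative (dn x)\<^sup>2 - e) (at x)" for x
    unfolding Z_def by (auto intro!: derivative_eq_intros E)
  have Z_per: "Z (x + T) = Z x" for x
  proof -
    have "Z (x + T) - Z x = Z (0 + T) - Z 0"
    proof (rule DERIV_isconst_all[where f="\<lambda>x. Z (x + T) - Z x"])
      have "((\<lambda>x. Z (x + T)) has_real_derivative ((dn (x + T))\<^sup>2 - e) * 1) (at x)" for x
        by (rule DERIV_chain2[OF Z]) (auto intro!: derivative_eq_intros)
      from DERIV_diff[OF this Z]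
      show "\<forall>x. ((\<lambda>x. Z (x + T) - Z x) has_real_derivative 0) (at x)"
        by (simp add: dn_add_T)
    qed
    then show ?thesis using T_pos by (simp add: Z_def e_def)
  qed
  have "kc < e"
  proof (rule ccontr)
    assume "\<not> kc < e"
    then have le: "e \<le> kc" by simp
    \<comment> \<open>The derivative of \<open>dn' / dn\<close> is kc^2/dn^2 - dn^2; it trades one
      dn^2 for its reciprocal and completes the square.\<close>
    define G where "G = (\<lambda>x. 2 * E x - 2 * kc * x + dn' x / dn x)"
    have G: "(G has_real_derivative (dn x - kc / dn x)\<^sup>2) (at x)" for x
    proof -
      have "(G has_real_derivative 2 * (dn x)\<^sup>2 - 2 * kc
          + ((- 2 * (dn x)^3 - 2 * w * dn x) * dn x - dn' x * dn' x) / (dn x * dn x)) (at x)"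
        unfolding G_def using dn_pos[of x]
        by (auto intro!: derivative_eq_intros E dn_deriv dn'_deriv)
      also have "(- 2 * (dn x)^3 - 2 * w * dn x) * dn x - dn' x * dn' x = kc\<^sup>2 - (dn x)^4"
        using dn'_sq[of x] by (simp add: algebra_simps power2_eq_square power3_eq_cube power4_eq_xxxx)
      also have "2 * (dn x)\<^sup>2 - 2 * kc + (kc\<^sup>2 - (dn x)^4) / (dn x * dn x) = (dn x - kc / dn x)\<^sup>2"
        using dn_pos[of x] by (simp add: field_simps power2_eq_square power4_eq_xxxx)
      finally show ?thesis .
    qed
    have "E T - E 0 = e * T" using T_pos by (simp add: e_def)
    also have "\<dots> \<le> kc * T" using le T_pos by simp
    finally have "G T \<le> G 0"
      using dn_add_T[of 0] dn'_add_T[of 0] by (simp add: G_def)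
    then have "(dn 0 - kc / dn 0)\<^sup>2 = 0"
      using T_pos dn_pos
      by (intro nonneg_deriv_zero[OF G, of T 0])
        (auto intro!: continuous_intros continuous_dn simp: less_imp_neq[symmetric])
    moreover have "dn 0 = 1"
      using am_ellF[of 0] by (simp add: dn_eq sn_def ellF_0)
    ultimately show False using kc_less_1[OF \<open>0 < k\<close>] by simp
  qed
  define d2 where "d2 = (\<lambda>x. - 2 * (dn x)^3 - 2 * w * dn x)"
  have d2: "(dn' has_real_derivative d2 x) (at x)" for x using dn'_deriv by (simp add: d2_def)
  have d3: "(d2 has_real_derivative - q x * dn' x) (at x)" for x
    unfolding d2_def q_def by (auto intro!: derivative_eq_intros dn_deriv simp: algebra_simps)
  define \<psi> where "\<psi> = (\<lambda>x. Z x * dn' x - e * dn x - (dn x)^3 - 2 * w * dn x)"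
  define \<psi>1 where "\<psi>1 = (\<lambda>x. Z x * d2 x - (2 * e + 2 * (dn x)\<^sup>2 + 2 * w) * dn' x)"
  define \<psi>2 where "\<psi>2 = (\<lambda>x. - (Z x * q x * dn' x) - (3 * e + (dn x)\<^sup>2 + 2 * w) * d2 x - 4 * dn x * (dn' x)\<^sup>2)"
  \<comment> \<open>The scaling derivative contributes the term \<open>w * e\<close>, the other
    function \<open>kc\<^sup>2\<close>.\<close>
  define \<alpha> where "\<alpha> = - 4 * (w * e + kc\<^sup>2)"
  define v where "v = T / 2 * (kc\<^sup>2 - e\<^sup>2)"
  show ?thesis
  proof (rule that[of \<psi> \<psi>1 \<psi>2 \<alpha> v])
    show "C2per \<psi> \<psi>1 \<psi>2"
      unfolding C2per_def
    proof (intro conjI allI)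
      show "(\<psi> has_real_derivative \<psi>1 x) (at x)" for x
        unfolding \<psi>_def \<psi>1_def
        by (auto intro!: derivative_eq_intros Z dn_deriv d2 simp: d2_def power3_eq_cube algebra_simps power2_eq_square)
      show "(\<psi>1 has_real_derivative \<psi>2 x) (at x)" for x
        unfolding \<psi>1_def \<psi>2_def
        by (auto intro!: derivative_eq_intros Z dn_deriv d2 d3 simp: d2_def q_def power3_eq_cube algebra_simps power2_eq_square)
      have "continuous_on UNIV Z"
        using Z by (meson DERIV_isCont continuous_at_imp_continuous_on)
      then show "continuous_on UNIV \<psi>2"
        unfolding \<psi>2_def d2_def by (intro continuous_intros continuous_dn continuous_dn' continuous_q)
      show "\<psi> (x + T) = \<psi> x" for x
        by (simp add: \<psi>_def Z_per dn_add_T dn'_add_T)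
    qed
    show "\<psi>2 x + q x * \<psi> x = - \<alpha> * dn x" for x
      unfolding \<psi>2_def \<psi>_def \<alpha>_def d2_def dn'_sq q_def by algebra
    show "((\<lambda>x. \<psi> x * dn x) has_integral v) {y..y + T}" for y
    proof -
      have "((\<lambda>x. \<psi> x * dn x - (kc\<^sup>2 - e\<^sup>2) / 2) has_integral 0) {y..y + T}"
      proof (rule has_integral_deriv_periodic)
        fix x
        have "((\<lambda>x. (Z x * (dn x)\<^sup>2 + dn x * dn' x - e * Z x) / 2) has_real_derivative
          (((dn x)\<^sup>2 - e) * (dn x)\<^sup>2 + Z x * (2 * dn x * dn' x) + ((dn' x)\<^sup>2 + dn x * d2 x)
            - e * ((dn x)\<^sup>2 - e)) / 2) (at x)"
          by (auto intro!: derivative_eq_intros Z dn_deriv d2 simp: d2_def field_simps power2_eq_square power3_eq_cube)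
        also have "(((dn x)\<^sup>2 - e) * (dn x)\<^sup>2 + Z x * (2 * dn x * dn' x) + ((dn' x)\<^sup>2 + dn x * d2 x)
            - e * ((dn x)\<^sup>2 - e)) / 2 = \<psi> x * dn x - (kc\<^sup>2 - e\<^sup>2) / 2"
          unfolding \<psi>_def d2_def dn'_sq
          by (simp add: field_simps power2_eq_square power3_eq_cube power4_eq_xxxx)
        finally show "((\<lambda>x. (Z x * (dn x)\<^sup>2 + dn x * dn' x - e * Z x) / 2) has_real_derivative
          \<psi> x * dn x - (kc\<^sup>2 - e\<^sup>2) / 2) (at x)" .
      qed (use T_pos in \<open>auto simp: Z_per dn_add_T dn'_add_T\<close>)
      from has_integral_add[OF this has_integral_const_real[of "(kc\<^sup>2 - e\<^sup>2) / 2" y "y + T"]]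
      show ?thesis using T_pos by (simp add: v_def mult.commute)
    qed
    \<comment> \<open>Positivity of \<alpha> follows from \<open>kc < e\<close> and 2 kc \<le> 1 +
      kc^2.\<close>
    have "\<alpha> = 2 * ((1 + kc\<^sup>2) * e - 2 * kc\<^sup>2)"
      by (simp add: \<alpha>_def w_eq algebra_simps)
    moreover have "2 * kc\<^sup>2 \<le> (1 + kc\<^sup>2) * kc"
      using mult_right_mono[OF sum_squares_bound[of 1 kc], of kc] kc_pos by (simp add: power2_eq_square)
    moreover have "(1 + kc\<^sup>2) * kc < (1 + kc\<^sup>2) * e"
      using \<open>kc < e\<close> by (intro mult_strict_left_mono) (auto simp: add_pos_nonneg)
    ultimately have "0 < \<alpha>" by (simp add: algebra_simps)
    moreover have "kc\<^sup>2 < e\<^sup>2"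
      using \<open>kc < e\<close> kc_pos by (intro power_strict_mono) auto
    then have "v < 0" using T_pos by (simp add: v_def mult_pos_neg)
    ultimately show "\<alpha> * v < 0" by (simp add: mult_pos_neg)
  qed
qed


text \<open>The two zeros per period of \<open>sn\<^sup>2 - \<beta>\<close> carry the argument: a multiple of \<open>\<psi>\<close> and one of
  \<open>sn cn\<close>, which spans the kernel, can be added to \<open>u\<close> so that the sum vanishes there.\<close>

lemma L_plus_form_nonneg:
  obtains y where "\<And>u u1 u2. C2per u u1 u2 \<Longrightarrow> ((\<lambda>x. u x * dn x) has_integral 0) {y..y + T} \<Longrightarrow>
    integral {y..y + T} (\<lambda>x. u x * (u2 x + q x * u x)) \<le> 0"
proof -
  obtain \<beta> m where \<beta>: "0 < \<beta>" "\<beta> \<le> 1 / 2" and m: "0 \<le> m"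
    and h: "\<And>x. ((\<lambda>x. (sn x)\<^sup>2 - \<beta>) has_real_derivative 2 * sn x * cn x * dn x) (at x)"
      "\<And>x. ((\<lambda>x. 2 * sn x * cn x * dn x) has_real_derivative - (q x + m) * ((sn x)\<^sup>2 - \<beta>)) (at x)"
    using sn_sq_eigenfunction by blast
  define \<theta> where "\<theta> = arcsin (sqrt \<beta>)"
  have sb: "0 < sqrt \<beta>" "- 1 < sqrt \<beta>" "sqrt \<beta> < 1" using \<beta> real_sqrt_gt_zero[of \<beta>] by (auto simp: real_sqrt_lt_1_iff simp del: real_sqrt_gt_0_iff)
  have \<theta>: "0 < \<theta>" "\<theta> < pi / 2" and sin_\<theta>: "sin \<theta> = sqrt \<beta>"
    using sb arcsin_lt_bounded[of "sqrt \<beta>"] arcsin_less_arcsin[of 0 "sqrt \<beta>"] by (auto simp: \<theta>_def)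
  \<comment> \<open>\<open>y\<close>, \<open>z\<close> and \<open>y + T\<close> have amplitudes
    -\<theta>, \<theta> and pi - \<theta>, so they are consecutive zeros of sn^2 - \<beta>.\<close>
  define y where "y = ellF k (- \<theta>)"
  define z where "z = ellF k \<theta>"
  have am: "jacobi_am y k = - \<theta>" "jacobi_am z k = \<theta>" "jacobi_am (y + T) k = pi - \<theta>"
    by (simp_all add: y_def z_def am_ellF am_add_T)
  have yz: "y < z" "z < y + T"
    using \<theta> ellF_add_pi[of "- \<theta>"]
    by (auto simp: y_def z_def strict_mono_less[OF ellF_strict_mono] simp flip: ellF_add_pi)
  have sn_end: "sn y = - sqrt \<beta>" "sn z = sqrt \<beta>" "sn (y + T) = sqrt \<beta>"
    by (simp_all add: sn_def am sin_\<theta>)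
  have cn_end: "cn y > 0" "cn z > 0" "cn (y + T) < 0"
    using \<theta> cos_gt_zero[of \<theta>] by (simp_all add: cn_def am)
  have sin_mono: "sin s < sin t" if "- (pi / 2) \<le> s" "s < t" "t \<le> pi / 2" for s t
    using sin_monotone_2pi that by simp
  have nz1: "(sn x)\<^sup>2 - \<beta> \<noteq> 0" if "y < x" "x < z" for x
  proof -
    have "- \<theta> < jacobi_am x k" "jacobi_am x k < \<theta>"
      using am_strict_mono[OF that(1)] am_strict_mono[OF that(2)] am by auto
    then have "sin (- \<theta>) < sn x" "sn x < sin \<theta>"
      using \<theta> by (auto simp: sn_def simp del: sin_minus intro!: sin_mono)
    then have "\<bar>sn x\<bar> < sqrt \<beta>" by (simp add: sin_\<theta> abs_less_iff)
    then have "(sn x)\<^sup>2 < \<beta>" using \<beta> by (metis abs_le_square_iff abs_of_pos not_le real_sqrt_pow2 less_imp_le sb(1))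
    then show ?thesis by simp
  qed
  have nz2: "(sn x)\<^sup>2 - \<beta> \<noteq> 0" if "z < x" "x < y + T" for x
  proof -
    have "\<theta> < jacobi_am x k" "jacobi_am x k < pi - \<theta>"
      using am_strict_mono[OF that(1)] am_strict_mono[OF that(2)] am by auto
    then have "- (pi / 2 - \<theta>) < jacobi_am x k - pi / 2" "jacobi_am x k - pi / 2 < pi / 2 - \<theta>"
      by auto
    then have "cos (pi / 2 - \<theta>) < cos (jacobi_am x k - pi / 2)"
      using \<theta> cos_monotone_0_pi[of "\<bar>jacobi_am x k - pi / 2\<bar>" "pi / 2 - \<theta>"] by (simp add: abs_less_iff)
    then have "sqrt \<beta> < sn x"
      by (simp add: cos_diff sn_def sin_\<theta>)
    then have "(sqrt \<beta>)\<^sup>2 < (sn x)\<^sup>2" using sb by (intro power_strict_mono) auto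
    then show ?thesis using \<beta> by simp
  qed
  have form: "integral {y..y + T} (\<lambda>x. f x * (f2 x + q x * f x)) \<le> 0"
    if f: "C2per f f1 f2" and f0: "f y = 0" "f z = 0" for f f1 f2
  proof -
    note C = C2perD[OF f]
    have f0': "f (y + T) = 0" using f0 C(3) by simp
    have "continuous_on A (\<lambda>x. f x * (f2 x + q x * f x))" for A
      by (intro continuous_intros C(6-8) continuous_q)
    then have "integral {y..y + T} (\<lambda>x. f x * (f2 x + q x * f x))
      = integral {y..z} (\<lambda>x. f x * (f2 x + q x * f x)) + integral {z..y + T} (\<lambda>x. f x * (f2 x + q x * f x))"
      using yz by (intro Henstock_Kurzweil_Integration.integral_combine[symmetric] integrable_continuous_real) auto
    also have "integral {y..z} (\<lambda>x. f x * (f2 x + q x * f x)) \<le> 0"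
      using dn_pos[of y] dn_pos[of z] cn_end sb \<beta> nz1
      by (intro jacobi_quadratic_form[OF yz(1) m C(1,2) h C(8) continuous_q])
        (auto simp: f0 sn_end)
    also have "integral {z..y + T} (\<lambda>x. f x * (f2 x + q x * f x)) \<le> 0"
      using dn_pos[of "y + T"] dn_pos[of z] cn_end sb \<beta> nz2
      by (intro jacobi_quadratic_form[OF yz(2) m C(1,2) h C(8) continuous_q])
        (auto simp: f0 f0' sn_end)
    finally show ?thesis by simp
  qed
  obtain \<psi> \<psi>1 \<psi>2 \<alpha> v where \<psi>: "C2per \<psi> \<psi>1 \<psi>2" and L\<psi>: "\<And>x. \<psi>2 x + q x * \<psi> x = - \<alpha> * dn x"
    and v: "\<And>y. ((\<lambda>x. \<psi> x * dn x) has_integral v) {y..y + T}" and \<alpha>v: "\<alpha> * v < 0"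
    using vakhitov_kolokolov by blast
  define \<kappa> where "\<kappa> = (\<lambda>x. sn x * cn x)"
  have \<kappa>: "C2per \<kappa> (\<lambda>x. ((cn x)\<^sup>2 - (sn x)\<^sup>2) * dn x) (\<lambda>x. - q x * \<kappa> x)"
    using C2per_sn_cn by (simp add: \<kappa>_def)
  \<comment> \<open>Expanding the form, Green's identity moves the operator onto \<psi> or \<kappa>.
    The \<kappa> terms vanish, the mixed \<psi> term vanishes by orthogonality, and the square of
    \<psi> leaves the multiple of \<alpha> v.\<close>
  have shifted: "integral {y..y + T} (\<lambda>x. u x * (u2 x + q x * u x)) - c\<^sup>2 * (\<alpha> * v)
      = integral {y..y + T} (\<lambda>x. (u x + c * \<psi> x + d * \<kappa> x) *
          (u2 x + c * \<psi>2 x + d * (- q x * \<kappa> x) + q x * (u x + c * \<psi> x + d * \<kappa> x)))"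
    if u: "C2per u u1 u2" and orth: "((\<lambda>x. u x * dn x) has_integral 0) {y..y + T}" for u u1 u2 c d
  proof -
    have "continuous_on {y..y + T} (\<lambda>x. u x * (u2 x + q x * u x))"
      by (intro continuous_intros C2perD(6-8)[OF u] continuous_q)
    then have "((\<lambda>x. u x * (u2 x + q x * u x)) has_integral
        integral {y..y + T} (\<lambda>x. u x * (u2 x + q x * u x))) {y..y + T}"
      by (intro integrable_integral integrable_continuous_real)
    note I = has_integral_add[OF has_integral_add[OF has_integral_add[OF has_integral_add[OF
          has_integral_add[OF this has_integral_mult_right[OF v[of y], of "- (c\<^sup>2 * \<alpha>)"]]
          has_integral_mult_right[OF orth, of "- 2 * c * \<alpha>"]]
          has_integral_mult_right[OF green[OF \<psi> u, of y], of c]]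
          has_integral_mult_right[OF green[OF \<kappa> u, of y], of d]]
          has_integral_mult_right[OF green[OF \<kappa> \<psi>, of y], of "c * d"]]
    have "u x * (u2 x + q x * u x) + - (c\<^sup>2 * \<alpha>) * (\<psi> x * dn x) + - 2 * c * \<alpha> * (u x * dn x)
        + c * (\<psi> x * u2 x - u x * \<psi>2 x) + d * (\<kappa> x * u2 x - u x * (- q x * \<kappa> x))
        + c * d * (\<kappa> x * \<psi>2 x - \<psi> x * (- q x * \<kappa> x))
        = (u x + c * \<psi> x + d * \<kappa> x) *
          (u2 x + c * \<psi>2 x + d * (- q x * \<kappa> x) + q x * (u x + c * \<psi> x + d * \<kappa> x))" for x
      using L\<psi>[of x] by algebra
    from integral_unique[OF I[unfolded this]] show ?thesis by simp
  qed
  have \<kappa>_end: "\<kappa> y \<noteq> 0" using sn_end cn_end sb by (simp add: \<kappa>_def)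
  \<comment> \<open>Otherwise some \<psi> + d \<kappa> vanishes at both zeros, yet its form is
    -\<alpha> v > 0, against \<open>form\<close>.\<close>
  have det: "\<psi> y * \<kappa> z - \<psi> z * \<kappa> y \<noteq> 0"
  proof
    assume det0: "\<psi> y * \<kappa> z - \<psi> z * \<kappa> y = 0"
    define d where "d = - \<psi> y / \<kappa> y"
    have zero: "C2per (\<lambda>_. 0) (\<lambda>_. 0) (\<lambda>_. 0)" by (simp add: C2per_def)
    have "0 + 1 * \<psi> y + d * \<kappa> y = 0" "0 + 1 * \<psi> z + d * \<kappa> z = 0"
      using \<kappa>_end det0 by (simp_all add: d_def field_simps)
    from form[OF C2per_lincomb[OF zero \<psi> \<kappa>] this]
    have "- (\<alpha> * v) \<le> 0"
      using shifted[OF zero, of 1 d] by simp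
    then show False using \<alpha>v by simp
  qed
  show ?thesis
  proof (rule that[of y])
    fix u u1 u2
    assume u: "C2per u u1 u2" and orth: "((\<lambda>x. u x * dn x) has_integral 0) {y..y + T}"
    define c where "c = (u z * \<kappa> y - u y * \<kappa> z) / (\<psi> y * \<kappa> z - \<psi> z * \<kappa> y)"
    define d where "d = (u y * \<psi> z - u z * \<psi> y) / (\<psi> y * \<kappa> z - \<psi> z * \<kappa> y)"
    have "u y + c * \<psi> y + d * \<kappa> y = 0" "u z + c * \<psi> z + d * \<kappa> z = 0"
      using det unfolding c_def d_def by (simp_all add: divide_simps) (simp_all add: algebra_simps)
    from form[OF C2per_lincomb[OF u \<psi> \<kappa>] this]
    have "integral {y..y + T} (\<lambda>x. u x * (u2 x + q x * u x)) - c\<^sup>2 * (\<alpha> * v) \<le> 0"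
      using shifted[OF u orth, of c d] by simp
    moreover have "c\<^sup>2 * (\<alpha> * v) \<le> 0" using \<alpha>v by (simp add: mult_nonneg_nonpos)
    ultimately show "integral {y..y + T} (\<lambda>x. u x * (u2 x + q x * u x)) \<le> 0" by simp
  qed
qed

text \<open>With \<open>h\<close> the logarithmic derivative of \<open>dn\<close>, a Riccati
  equation turns the form into minus the integral of (f' - h f)^2. Equality forces f' = h f, hence
  the kernel equation.\<close>

lemma L_minus_form_nonneg:
  assumes f: "C2per f f1 f2"
  shows "integral {y..y + T} (\<lambda>x. f x * (f2 x + 2 * ((dn x)\<^sup>2 + w) * f x)) \<le> 0" (is ?le)
    and "integral {y..y + T} (\<lambda>x. f x * (f2 x + 2 * ((dn x)\<^sup>2 + w) * f x)) = 0 \<Longrightarrow>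
      f2 x + 2 * ((dn x)\<^sup>2 + w) * f x = 0"
proof -
  note C = C2perD[OF f]
  define h where "h = (\<lambda>x. dn' x / dn x)"
  have h: "(h has_real_derivative - 2 * ((dn x)\<^sup>2 + w) - (h x)\<^sup>2) (at x)" for x
  proof -
    have "(h has_real_derivative ((- 2 * (dn x)^3 - 2 * w * dn x) * dn x - dn' x * dn' x) / (dn x * dn x)) (at x)"
      unfolding h_def using dn_pos[of x] by (auto intro!: derivative_eq_intros dn_deriv dn'_deriv)
    moreover have "((- 2 * (dn x)^3 - 2 * w * dn x) * dn x - dn' x * dn' x) / (dn x * dn x)
        = - 2 * ((dn x)\<^sup>2 + w) - (h x)\<^sup>2"
      using dn_pos[of x] by (simp add: h_def field_simps power2_eq_square power3_eq_cube power4_eq_xxxx)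
    ultimately show ?thesis by simp
  qed
  define F where "F = (\<lambda>x. f x * (f2 x + 2 * ((dn x)\<^sup>2 + w) * f x))"
  define g where "g = (\<lambda>x. (f1 x - h x * f x)\<^sup>2)"
  have cont_h: "continuous_on A h" for A
    using h by (meson DERIV_isCont continuous_at_imp_continuous_on)
  have cont_g: "continuous_on A g" for A
    unfolding g_def by (intro continuous_intros cont_h C(6-8))
  have "((\<lambda>x. F x + g x) has_integral 0) {y..y + T}"
  proof (rule has_integral_deriv_periodic)
    show "((\<lambda>x. f x * f1 x - h x * (f x)\<^sup>2) has_real_derivative F x + g x) (at x)" for x
      by (auto intro!: derivative_eq_intros h C(1,2) simp: F_def g_def algebra_simps power2_eq_square)
  qed (use T_pos in \<open>auto simp: h_def C(3,4) dn_add_T dn'_add_T\<close>)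
  moreover have g_int: "(g has_integral integral {y..y + T} g) {y..y + T}"
    by (intro integrable_integral integrable_continuous_real cont_g)
  ultimately have "((\<lambda>x. F x + g x - g x) has_integral 0 - integral {y..y + T} g) {y..y + T}"
    by (rule has_integral_diff)
  then have F: "integral {y..y + T} F = - integral {y..y + T} g"
    by (simp add: integral_unique)
  have "0 \<le> integral {y..y + T} g"
    by (rule integral_nonneg) (use g_int in \<open>auto simp: g_def integrable_on_def\<close>)
  then show ?le using F by (simp add: F_def)
  assume "integral {y..y + T} (\<lambda>x. f x * (f2 x + 2 * ((dn x)\<^sup>2 + w) * f x)) = 0"
  then have g0: "(g has_integral 0) {y..y + T}" using F g_int by (simp add: F_def)
  have on_period: "g x = 0" if "x \<in> {y..y + T}" for x
    using has_integral_0_cbox_imp_0[of y "y + T" g] g0 cont_g that T_pos by (auto simp: g_def)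
  have "g (x + T) = g x" for x
    by (simp add: g_def h_def C(3,4) dn_add_T dn'_add_T)
  then have "g x = 0" for x
    using periodic_eq_0[of g T y x] on_period T_pos by blast
  then have f1: "f1 x = h x * f x" for x by (simp add: g_def)
  then have "(f1 has_real_derivative (- 2 * ((dn x)\<^sup>2 + w) - (h x)\<^sup>2) * f x + f1 x * h x) (at x)"
    using DERIV_mult[OF h C(1), of x] by (simp flip: f1)
  from DERIV_unique[OF this C(2)] show "f2 x + 2 * ((dn x)\<^sup>2 + w) * f x = 0"
    by (simp add: f1 algebra_simps power2_eq_square)
qed


text \<open>Real and imaginary parts bring the complex system within reach of the real-valued forms;
  the equations themselves make the second derivatives continuous.\<close>

lemma C2per_eigenfunction_parts:
  fixes U V :: "real \<Rightarrow> complex"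
  assumes eig: "periodic_eigenfunction dn w T \<mu> U V"
  defines "u1 \<equiv> \<lambda>x. Re (U x)" and "u2 \<equiv> \<lambda>x. Im (U x)" and "v1 \<equiv> \<lambda>x. Re (V x)" and "v2 \<equiv> \<lambda>x. Im (V x)"
    and "r \<equiv> Re \<mu>" and "s \<equiv> Im \<mu>"
  shows "C2per u1 (\<lambda>x. Re (D U x)) (\<lambda>x. 2 * (r * v1 x - s * v2 x) - q x * u1 x)"
    and "C2per u2 (\<lambda>x. Im (D U x)) (\<lambda>x. 2 * (s * v1 x + r * v2 x) - q x * u2 x)"
    and "C2per v1 (\<lambda>x. Re (D V x)) (\<lambda>x. - 2 * (r * u1 x - s * u2 x) - 2 * ((dn x)\<^sup>2 + w) * v1 x)"
    and "C2per v2 (\<lambda>x. Im (D V x)) (\<lambda>x. - 2 * (s * u1 x + r * u2 x) - 2 * ((dn x)\<^sup>2 + w) * v2 x)"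
proof -
  have diff: "U differentiable (at x)" "D U differentiable (at x)"
    "V differentiable (at x)" "D V differentiable (at x)"
    and per: "U (x + T) = U x" "V (x + T) = V x" for x
    using eig by (auto simp: periodic_eigenfunction_def twice_differentiable_def)
  have "continuous_on UNIV U" "continuous_on UNIV V"
    using diff by (auto intro!: continuous_at_imp_continuous_on differentiable_imp_continuous_within)
  then have cont: "continuous_on UNIV u1" "continuous_on UNIV u2" "continuous_on UNIV v1" "continuous_on UNIV v2"
    unfolding u1_def u2_def v1_def v2_def by (auto intro!: continuous_intros)
  note d = has_real_derivative_Re[OF diff(1)] has_real_derivative_Im[OF diff(1)]
    has_real_derivative_Re[OF diff(3)] has_real_derivative_Im[OF diff(3)]
  note dd = has_real_derivative_Re[OF diff(2)] has_real_derivative_Im[OF diff(2)]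
    has_real_derivative_Re[OF diff(4)] has_real_derivative_Im[OF diff(4)]
  have "Re (D (D U) x) = 2 * (r * v1 x - s * v2 x) - q x * u1 x"
    "Im (D (D U) x) = 2 * (s * v1 x + r * v2 x) - q x * u2 x"
    "Re (D (D V) x) = - 2 * (r * u1 x - s * u2 x) - 2 * ((dn x)\<^sup>2 + w) * v1 x"
    "Im (D (D V) x) = - 2 * (s * u1 x + r * u2 x) - 2 * ((dn x)\<^sup>2 + w) * v2 x" for x
    unfolding periodic_eigenfunction_deriv2[OF eig] u1_def u2_def v1_def v2_def r_def s_def q_def
    by (simp_all add: algebra_simps)
  note dd = dd[unfolded this]
  show "C2per u1 (\<lambda>x. Re (D U x)) (\<lambda>x. 2 * (r * v1 x - s * v2 x) - q x * u1 x)"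
    "C2per u2 (\<lambda>x. Im (D U x)) (\<lambda>x. 2 * (s * v1 x + r * v2 x) - q x * u2 x)"
    "C2per v1 (\<lambda>x. Re (D V x)) (\<lambda>x. - 2 * (r * u1 x - s * u2 x) - 2 * ((dn x)\<^sup>2 + w) * v1 x)"
    "C2per v2 (\<lambda>x. Im (D V x)) (\<lambda>x. - 2 * (s * u1 x + r * u2 x) - 2 * ((dn x)\<^sup>2 + w) * v2 x)"
    unfolding C2per_def
    using d dd cont by (auto simp: u1_def u2_def v1_def v2_def per intro!: continuous_intros continuous_q continuous_dn)
qed

text \<open>The two forms give \<open>r * J1\<close> opposite signs, so it is 0 and equality holds
  for \<open>L_minus\<close>. Then \<mu> U = 0, and both components vanish.\<close>

lemma coperiodic_stability:
  fixes U V :: "real \<Rightarrow> complex"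
  assumes eig: "periodic_eigenfunction dn w T \<mu> U V"
  shows "Re \<mu> = 0"
proof (rule ccontr)
  define r s where "r = Re \<mu>" and "s = Im \<mu>"
  define u1 u2 v1 v2 where "u1 = (\<lambda>x. Re (U x))" and "u2 = (\<lambda>x. Im (U x))"
    and "v1 = (\<lambda>x. Re (V x))" and "v2 = (\<lambda>x. Im (V x))"
  assume "Re \<mu> \<noteq> 0"
  then have r: "r \<noteq> 0" by (simp add: r_def)
  then have norm_pos: "r\<^sup>2 + s\<^sup>2 > 0" by (simp add: sum_power2_gt_zero_iff)
  have C: "C2per u1 (\<lambda>x. Re (D U x)) (\<lambda>x. 2 * (r * v1 x - s * v2 x) - q x * u1 x)"
    "C2per u2 (\<lambda>x. Im (D U x)) (\<lambda>x. 2 * (s * v1 x + r * v2 x) - q x * u2 x)"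
    "C2per v1 (\<lambda>x. Re (D V x)) (\<lambda>x. - 2 * (r * u1 x - s * u2 x) - 2 * ((dn x)\<^sup>2 + w) * v1 x)"
    "C2per v2 (\<lambda>x. Im (D V x)) (\<lambda>x. - 2 * (s * u1 x + r * u2 x) - 2 * ((dn x)\<^sup>2 + w) * v2 x)"
    using C2per_eigenfunction_parts[OF eig] by (simp_all only: r_def s_def u1_def u2_def v1_def v2_def)
  \<comment> \<open>Multiplication by the nonzero number \<mu> is injective, written in real
    coordinates.\<close>
  have solve: "X = 0 \<and> Y = 0" if "r * X - s * Y = 0" "s * X + r * Y = 0" for X Y :: real
  proof -
    have "(r\<^sup>2 + s\<^sup>2) * X = r * (r * X - s * Y) + s * (s * X + r * Y)"
      "(r\<^sup>2 + s\<^sup>2) * Y = r * (s * X + r * Y) - s * (r * X - s * Y)"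
      by (simp_all add: algebra_simps power2_eq_square)
    then have "(r\<^sup>2 + s\<^sup>2) * X = 0" "(r\<^sup>2 + s\<^sup>2) * Y = 0" using that by simp_all
    then show ?thesis using norm_pos by (metis less_irrefl mult_eq_0_iff)
  qed
  obtain y where pos: "\<And>u u1 u2. C2per u u1 u2 \<Longrightarrow> ((\<lambda>x. u x * dn x) has_integral 0) {y..y + T} \<Longrightarrow>
    integral {y..y + T} (\<lambda>x. u x * (u2 x + q x * u x)) \<le> 0"
    using L_plus_form_nonneg by blast
  define I where "I = (\<lambda>f::real\<Rightarrow>real. integral {y..y + T} f)"
  have hI: "(f has_integral I f) {y..y + T}" if "continuous_on UNIV f" for f
    unfolding I_def using that
    by (intro integrable_integral integrable_continuous_real) (auto intro: continuous_on_subset)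
  have lin: "I (\<lambda>x. c * f x + d * g x) = c * I f + d * I g"
    if "continuous_on UNIV f" "continuous_on UNIV g" for f g c d
    using has_integral_add[OF has_integral_mult_right[OF hI[OF that(1)], of c]
        has_integral_mult_right[OF hI[OF that(2)], of d]]
    by (auto simp: I_def intro: integral_unique)
  have cont: "continuous_on UNIV u1" "continuous_on UNIV u2" "continuous_on UNIV v1" "continuous_on UNIV v2"
    using C2perD(6)[OF C(1)] C2perD(6)[OF C(2)] C2perD(6)[OF C(3)] C2perD(6)[OF C(4)] by auto
  \<comment> \<open>Pairing the equations for \<open>V\<close> with the kernel element
    \<open>dn\<close> shows that \<mu> times the integral of \<open>U\<close> against
    \<open>dn\<close> is 0.\<close>
  have orth: "((\<lambda>x. u1 x * dn x) has_integral 0) {y..y + T} \<and> ((\<lambda>x. u2 x * dn x) has_integral 0) {y..y + T}"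
  proof -
    have c: "continuous_on UNIV (\<lambda>x. u1 x * dn x)" "continuous_on UNIV (\<lambda>x. u2 x * dn x)"
      by (intro continuous_intros cont continuous_dn)+
    have "I (\<lambda>x. (- 2 * r) * (u1 x * dn x) + (2 * s) * (u2 x * dn x)) = 0"
      unfolding I_def
      by (rule integral_unique[OF has_integral_eq[OF _ green[OF C2per_dn C(3), of y]]])
        (simp add: algebra_simps power2_eq_square power3_eq_cube)
    moreover have "I (\<lambda>x. (- 2 * s) * (u1 x * dn x) + (- 2 * r) * (u2 x * dn x)) = 0"
      unfolding I_def
      by (rule integral_unique[OF has_integral_eq[OF _ green[OF C2per_dn C(4), of y]]])
        (simp add: algebra_simps power2_eq_square power3_eq_cube)
    ultimately have "r * I (\<lambda>x. u1 x * dn x) - s * I (\<lambda>x. u2 x * dn x) = 0"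
      "s * I (\<lambda>x. u1 x * dn x) + r * I (\<lambda>x. u2 x * dn x) = 0"
      unfolding lin[OF c] by linarith+
    then have "I (\<lambda>x. u1 x * dn x) = 0 \<and> I (\<lambda>x. u2 x * dn x) = 0" by (rule solve)
    then show ?thesis using hI[OF c(1)] hI[OF c(2)] by simp
  qed
  \<comment> \<open>\<open>J1\<close> and \<open>J2\<close> are the real and imaginary parts of the
    integral of \<open>U\<close> times the conjugate of \<open>V\<close>. Symmetry of the two
    operators gives the two linear relations between them.\<close>
  define J1 where "J1 = I (\<lambda>x. u1 x * v1 x + u2 x * v2 x)"
  define J2 where "J2 = I (\<lambda>x. u2 x * v1 x - u1 x * v2 x)"
  have cJ: "continuous_on UNIV (\<lambda>x. u1 x * v1 x + u2 x * v2 x)"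
    "continuous_on UNIV (\<lambda>x. u2 x * v1 x - u1 x * v2 x)"
    by (intro continuous_intros cont)+
  note linJ = lin[OF cJ, folded J1_def J2_def]
  have c_prod: "continuous_on UNIV (\<lambda>x. u1 x * (r * v1 x - s * v2 x))"
    "continuous_on UNIV (\<lambda>x. u2 x * (s * v1 x + r * v2 x))"
    "continuous_on UNIV (\<lambda>x. v1 x * (r * u1 x - s * u2 x))"
    "continuous_on UNIV (\<lambda>x. v2 x * (s * u1 x + r * u2 x))"
    by (intro continuous_intros cont)+
  have "2 * (s * J1 + r * J2) = 0"
  proof -
    have "I (\<lambda>x. (2 * s) * (u1 x * v1 x + u2 x * v2 x) + (2 * r) * (u2 x * v1 x - u1 x * v2 x)) = 0"
      unfolding I_def
      by (rule integral_unique[OF has_integral_eq[OF _ green[OF C(4,3), of y]]]) (simp add: algebra_simps)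
    then show ?thesis unfolding linJ by simp
  qed
  moreover have "2 * (s * J1 - r * J2) = 0"
  proof -
    have "I (\<lambda>x. (2 * s) * (u1 x * v1 x + u2 x * v2 x) + (- 2 * r) * (u2 x * v1 x - u1 x * v2 x)) = 0"
      unfolding I_def
      by (rule integral_unique[OF has_integral_eq[OF _ green[OF C(1,2), of y]]]) (simp add: algebra_simps)
    then show ?thesis unfolding linJ by simp
  qed
  ultimately have J: "s * J1 = 0" "J2 = 0" using r by auto
  \<comment> \<open>After inserting the eigenvalue equations, the potential terms drop out of both
    forms.\<close>
  have cancel: "a * (2 * X - Q + Q) = 2 * (a * X)" "a * (- 2 * X - Q + Q) = - 2 * (a * X)"
    for a X Q :: real by simp_all
  have plus: "0 \<ge> I (\<lambda>x. 2 * (u1 x * (r * v1 x - s * v2 x)) + 2 * (u2 x * (s * v1 x + r * v2 x)))"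
  proof -
    have "I (\<lambda>x. u1 x * (r * v1 x - s * v2 x)) \<le> 0" "I (\<lambda>x. u2 x * (s * v1 x + r * v2 x)) \<le> 0"
      using pos[OF C(1), unfolded cancel] pos[OF C(2), unfolded cancel] orth by (simp_all add: I_def)
    then show ?thesis unfolding lin[OF c_prod(1,2)] by simp
  qed
  have minus1: "0 \<le> I (\<lambda>x. v1 x * (r * u1 x - s * u2 x))"
    and minus1_0: "I (\<lambda>x. v1 x * (r * u1 x - s * u2 x)) = 0 \<Longrightarrow> r * u1 x - s * u2 x = 0" for x
    using L_minus_form_nonneg(1)[OF C(3), of y, unfolded cancel]
      L_minus_form_nonneg(2)[OF C(3), of y x, unfolded cancel] by (simp_all add: I_def)
  have minus2: "0 \<le> I (\<lambda>x. v2 x * (s * u1 x + r * u2 x))"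
    and minus2_0: "I (\<lambda>x. v2 x * (s * u1 x + r * u2 x)) = 0 \<Longrightarrow> s * u1 x + r * u2 x = 0" for x
    using L_minus_form_nonneg(1)[OF C(4), of y, unfolded cancel]
      L_minus_form_nonneg(2)[OF C(4), of y x, unfolded cancel] by (simp_all add: I_def)
  have "I (\<lambda>x. 2 * (u1 x * (r * v1 x - s * v2 x)) + 2 * (u2 x * (s * v1 x + r * v2 x)))
    = I (\<lambda>x. (2 * r) * (u1 x * v1 x + u2 x * v2 x) + (2 * s) * (u2 x * v1 x - u1 x * v2 x))"
    by (simp add: algebra_simps)
  with plus J linJ have "r * J1 \<le> 0" by (simp add: mult.commute)
  moreover have "I (\<lambda>x. 1 * (v1 x * (r * u1 x - s * u2 x)) + 1 * (v2 x * (s * u1 x + r * u2 x)))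
    = I (\<lambda>x. r * (u1 x * v1 x + u2 x * v2 x) + (- s) * (u2 x * v1 x - u1 x * v2 x))"
    by (simp add: algebra_simps)
  then have "I (\<lambda>x. v1 x * (r * u1 x - s * u2 x)) + I (\<lambda>x. v2 x * (s * u1 x + r * u2 x)) = r * J1"
    unfolding linJ lin[OF c_prod(3,4)] using J by simp
  ultimately have "I (\<lambda>x. v1 x * (r * u1 x - s * u2 x)) = 0" "I (\<lambda>x. v2 x * (s * u1 x + r * u2 x)) = 0"
    using minus1 minus2 by linarith+
  then have "u1 x = 0 \<and> u2 x = 0" for x
    using minus1_0 minus2_0 solve by blast
  then have U: "U = (\<lambda>x. 0)" by (auto simp: u1_def u2_def complex_eq_iff)
  have "\<mu> * V x = 0" for x
    using periodic_eigenfunction_deriv2(1)[OF eig, of x] by (simp add: U)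
  moreover have "\<mu> \<noteq> 0" using \<open>Re \<mu> \<noteq> 0\<close> by auto
  ultimately have "V = (\<lambda>x. 0)" by (simp add: fun_eq_iff)
  with U eig show False by (simp add: periodic_eigenfunction_def)
qed


section \<open>Subharmonic instability\<close>

text \<open>The time part of the Lax pair at the spectral parameter \<open>\<i> \<eta>\<close> has the matrix
  \<open>\<i> (a, b; - (b - dn'), - a)\<close> in the frame of the stationary solution, with eigenvalues \<open>\<plusminus> Om\<close>.\<close>

definition lax_a :: "real \<Rightarrow> real \<Rightarrow> real" where
  "lax_a \<eta> x = \<eta>\<^sup>2 + (dn x)\<^sup>2 / 2 + w / 2"

definition lax_b :: "real \<Rightarrow> real \<Rightarrow> real" where
  "lax_b \<eta> x = \<eta> * dn x + dn' x / 2"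

definition Om :: "real \<Rightarrow> real" where
  "Om \<eta> = sqrt ((\<eta>\<^sup>2 - (1 - kc)\<^sup>2 / 4) * ((1 + kc)\<^sup>2 / 4 - \<eta>\<^sup>2))"

text \<open>Minus the change over one period of the argument of the squared Lax component
  \<open>p\<close>, so the multiplier is \<open>cis (- floquet_phase \<eta>)\<close>.\<close>

definition floquet_phase :: "real \<Rightarrow> real" where
  "floquet_phase \<eta> = integral {0..T} (\<lambda>x. 2 * Om \<eta> * dn x / lax_b \<eta> x)"

section \<open>Algebra of the Lax matrix on the instability band\<close>

lemma Om_sq:
  assumes "(1 - kc) / 2 < \<eta>" "\<eta> \<le> (1 + kc) / 2"
  shows "(Om \<eta>)\<^sup>2 = - (\<eta>^4) + (1 + kc\<^sup>2) / 2 * \<eta>\<^sup>2 - ((1 - kc\<^sup>2) / 4)\<^sup>2"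
    and "0 \<le> Om \<eta>" and "\<eta> < (1 + kc) / 2 \<Longrightarrow> 0 < Om \<eta>"
proof -
  have "((1 - kc) / 2)\<^sup>2 < \<eta>\<^sup>2" using assms kc_le_1 by (intro power_strict_mono) auto
  then have 1: "0 < \<eta>\<^sup>2 - (1 - kc)\<^sup>2 / 4" by (simp add: power_divide)
  have "\<eta>\<^sup>2 \<le> ((1 + kc) / 2)\<^sup>2" using assms kc_le_1 by (intro power_mono) auto
  then have 2: "0 \<le> (1 + kc)\<^sup>2 / 4 - \<eta>\<^sup>2" by (simp add: power_divide)
  have "(Om \<eta>)\<^sup>2 = (\<eta>\<^sup>2 - (1 - kc)\<^sup>2 / 4) * ((1 + kc)\<^sup>2 / 4 - \<eta>\<^sup>2)"
    using 1 2 by (simp add: Om_def)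
  also have "\<dots> = - (\<eta>^4) + (1 + kc\<^sup>2) / 2 * \<eta>\<^sup>2 - ((1 - kc\<^sup>2) / 4)\<^sup>2"
    by (simp add: field_simps power2_eq_square power4_eq_xxxx)
  finally show "(Om \<eta>)\<^sup>2 = - (\<eta>^4) + (1 + kc\<^sup>2) / 2 * \<eta>\<^sup>2 - ((1 - kc\<^sup>2) / 4)\<^sup>2" .
  show "0 \<le> Om \<eta>" using 1 2 by (simp add: Om_def)
  assume "\<eta> < (1 + kc) / 2"
  then have "\<eta>\<^sup>2 < ((1 + kc) / 2)\<^sup>2" using assms kc_le_1 by (intro power_strict_mono) auto
  then show "0 < Om \<eta>" using 1 by (simp add: Om_def power_divide)
qed

text \<open>The squares differ by the perfect square (dn^2 - kc)^2. The constant fixes the lower end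
  of the band, where \<open>lax_b\<close> must stay positive.\<close>

lemma abs_dn'_le: "\<bar>dn' x\<bar> \<le> (1 - kc) * dn x"
proof (rule power2_le_imp_le)
  have "(dn' x)\<^sup>2 = ((1 - kc) * dn x)\<^sup>2 - ((dn x)\<^sup>2 - kc)\<^sup>2"
    unfolding dn'_sq w_eq by (simp add: field_simps power2_eq_square power4_eq_xxxx)
  then show "\<bar>dn' x\<bar>\<^sup>2 \<le> ((1 - kc) * dn x)\<^sup>2" by simp
  show "0 \<le> (1 - kc) * dn x" using kc_le_1 dn_pos[of x] by simp
qed

lemma lax_b_pos:
  assumes "(1 - kc) / 2 < \<eta>"
  shows "0 < lax_b \<eta> x" "dn' x < lax_b \<eta> x"
proof -
  have "(1 - kc) / 2 * dn x < \<eta> * dn x"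
    using assms dn_pos by (rule mult_strict_right_mono)
  then show "0 < lax_b \<eta> x" "dn' x < lax_b \<eta> x"
    using abs_dn'_le[of x] unfolding lax_b_def by (auto simp: abs_le_iff)
qed

text \<open>The traceless Lax matrix has a determinant independent of \<open>x\<close>; the first
  integral of \<open>dn\<close> exhibits this.\<close>

lemma lax_det:
  assumes "(1 - kc) / 2 < \<eta>" "\<eta> \<le> (1 + kc) / 2"
  shows "(lax_a \<eta> x)\<^sup>2 + (Om \<eta>)\<^sup>2 = lax_b \<eta> x * (lax_b \<eta> x - dn' x)"
proof -
  have "lax_b \<eta> x * (lax_b \<eta> x - dn' x) = \<eta>\<^sup>2 * (dn x)\<^sup>2 - (dn' x)\<^sup>2 / 4"
    by (simp add: lax_b_def field_simps power2_eq_square)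
  then show ?thesis
    unfolding Om_sq(1)[OF assms] dn'_sq lax_a_def w_eq
    by (simp add: field_simps power2_eq_square power4_eq_xxxx)
qed

lemma lax_a_deriv: "(lax_a \<eta> has_real_derivative dn x * dn' x) (at x)"
  unfolding lax_a_def[abs_def] by (auto intro!: derivative_eq_intros dn_deriv)

lemma lax_b_deriv: "(lax_b \<eta> has_real_derivative 2 * \<eta> * lax_b \<eta> x - 2 * dn x * lax_a \<eta> x) (at x)"
  unfolding lax_b_def[abs_def]
  by (auto intro!: derivative_eq_intros dn_deriv dn'_deriv
      simp: lax_a_def field_simps power2_eq_square power3_eq_cube)

lemma continuous_lax_b: "continuous_on A (lax_b \<eta>)"
  unfolding lax_b_def[abs_def] by (intro continuous_intros continuous_dn continuous_dn') auto

text \<open>If \<open>\<psi>\<close> solves the Lax pair, then \<open>p = \<psi>\<^sub>1\<^sup>2\<close>, \<open>m = \<psi>\<^sub>1 \<psi>\<^sub>2\<close>, \<open>r = \<psi>\<^sub>2\<^sup>2\<close> give an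
  eigenfunction \<open>(\<i> (p - r), p + r)\<close> with eigenvalue \<open>2 Om\<close>.\<close>

lemma floquet_eigenfunction:
  assumes \<eta>: "(1 - kc) / 2 < \<eta>" "\<eta> < (1 + kc) / 2" and phase: "real P * floquet_phase \<eta> = 2 * pi"
  shows "\<exists>\<mu> U V. Re \<mu> > 0 \<and> periodic_eigenfunction dn w (real P * T) \<mu> U V"
proof -
  define a b \<Omega> where "a = lax_a \<eta>" and "b = lax_b \<eta>" and "\<Omega> = Om \<eta>"
  note b_pos = lax_b_pos[OF \<eta>(1), folded b_def]
  have b_nz: "b x \<noteq> 0" for x using b_pos(1)[of x] by simp
  have \<Omega>: "0 < \<Omega>" using Om_sq(3)[OF \<eta>(1) less_imp_le[OF \<eta>(2)]] \<eta>(2) by (simp add: \<Omega>_def)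
  have det: "(a x)\<^sup>2 + \<Omega>\<^sup>2 = b x * (b x - dn' x)" for x
    using lax_det[of \<eta> x] \<eta> by (simp add: a_def b_def \<Omega>_def)
  \<comment> \<open>The logarithmic derivative of \<open>p\<close> is 2 \<eta> - 2 dn (a + i
    \<Omega>) / b. Its real part is b'/b, its imaginary part is \<open>t\<close>.\<close>
  define t where "t = (\<lambda>x. - (2 * \<Omega> * dn x / b x))"
  have "continuous_on UNIV t"
    unfolding t_def b_def using b_nz
    by (intro continuous_intros continuous_dn continuous_lax_b) (auto simp: b_def)
  then obtain \<theta> where \<theta>: "\<And>x. (\<theta> has_real_derivative t x) (at x)"
    using antiderivative_continuous_real by blast
  have t_per: "t (x + T) = t x" for x
    by (simp add: t_def b_def lax_b_def dn_add_T dn'_add_T)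
  have \<theta>_T: "\<theta> (x + T) = \<theta> x - floquet_phase \<eta>" for x
  proof -
    have "\<theta> (x + T) - \<theta> x = \<theta> (0 + T) - \<theta> 0"
    proof (rule DERIV_isconst_all[where f="\<lambda>x. \<theta> (x + T) - \<theta> x"])
      have "((\<lambda>x. \<theta> (x + T)) has_real_derivative t (x + T) * 1) (at x)" for x
        by (rule DERIV_chain2[OF \<theta>]) (auto intro!: derivative_eq_intros)
      from DERIV_diff[OF this \<theta>]
      show "\<forall>x. ((\<lambda>x. \<theta> (x + T) - \<theta> x) has_real_derivative 0) (at x)"
        by (simp add: t_per)
    qed
    moreover have "(t has_integral \<theta> T - \<theta> 0) {0..T}"
      using T_pos by (intro has_integral_real_deriv[OF \<theta>]) simp
    then have "((\<lambda>x. - t x) has_integral - (\<theta> T - \<theta> 0)) {0..T}" by (rule has_integral_neg)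
    then have "floquet_phase \<eta> = - (\<theta> T - \<theta> 0)"
      by (simp add: floquet_phase_def t_def \<Omega>_def b_def integral_unique)
    ultimately show ?thesis by simp
  qed
  have \<theta>_nT: "\<theta> (x + real n * T) = \<theta> x - real n * floquet_phase \<eta>" for x n
  proof (induction n)
    case (Suc n)
    have "\<theta> (x + real (Suc n) * T) = \<theta> ((x + real n * T) + T)" by (simp add: algebra_simps)
    also have "\<dots> = \<theta> x - real (Suc n) * floquet_phase \<eta>"
      unfolding \<theta>_T Suc by (simp add: algebra_simps)
    finally show ?case .
  qed simp
  have dn_nT: "dn (x + real n * T) = dn x \<and> dn' (x + real n * T) = dn' x" for x n
  proof (induction n)
    case (Suc n)
    have "x + real (Suc n) * T = (x + real n * T) + T" by (simp add: algebra_simps)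
    then show ?case using Suc by (simp only: dn_add_T dn'_add_T)
  qed simp
  define c where "c = (\<lambda>f (x::real). complex_of_real (f x))"
  have c_deriv: "(c f has_vector_derivative of_real f') (at x)" if "(f has_real_derivative f') (at x)" for f f' x
    using that unfolding c_def
    by (intro has_vector_derivative_of_real) (simp add: has_real_derivative_iff_has_vector_derivative)
  define e where "e = (\<lambda>x. cis (\<theta> x))"
  have e: "(e has_vector_derivative \<i> * of_real (t x) * e x) (at x)" for x
    unfolding e_def has_vector_derivative_complex_iff
    by (auto intro!: derivative_eq_intros \<theta>)
  \<comment> \<open>The eigenvector relation for \<Omega> forces the ratio m / p = -z / b, and then
    r = m^2 / p.\<close>
  define z where "z = (\<lambda>x. c a x + \<i> * of_real \<Omega>)"
  define p where "p = (\<lambda>x. c b x * e x)"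
  define m where "m = (\<lambda>x. - z x * e x)"
  define r where "r = (\<lambda>x. c (\<lambda>x. 1 / b x) x * (z x * z x) * e x)"
  note a' = c_deriv[OF lax_a_deriv, of \<eta>, folded a_def]
  have z': "(z has_vector_derivative of_real (dn x * dn' x)) (at x)" for x
    unfolding z_def by (auto intro!: derivative_eq_intros a')
  note b' = c_deriv[OF lax_b_deriv, of \<eta>, folded a_def b_def]
  have "((\<lambda>x. 1 / b x) has_real_derivative - (2 * \<eta> * b x - 2 * dn x * a x) * (1 / b x)\<^sup>2) (at x)" for x
    using b_nz lax_b_deriv[of \<eta> x, folded a_def b_def]
    by (auto intro!: derivative_eq_intros simp: power2_eq_square)
  note ib' = c_deriv[OF this]
  \<comment> \<open>The reciprocal is kept as a separate quantity, tied to \<open>b\<close> by this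
    polynomial relation alone, so that \<open>algebra\<close> applies.\<close>
  have inv: "c b x * c (\<lambda>x. 1 / b x) x = 1" for x using b_nz by (simp add: c_def)
  have t_eq: "of_real (t x) = - 2 * of_real \<Omega> * c dn x * c (\<lambda>x. 1 / b x) x" for x
    by (simp add: t_def c_def)
  have det': "(c a x)\<^sup>2 + (of_real \<Omega>)\<^sup>2 = c b x * (c b x - c dn' x)" for x
    using arg_cong[OF det[of x], of complex_of_real] by (simp add: c_def)
  have ii: "\<i> * \<i> = -1" by simp
  have p': "(p has_vector_derivative 2 * of_real \<eta> * p x + 2 * c dn x * m x) (at x)" for x
  proof -
    have "(p has_vector_derivative c b x * (\<i> * of_real (t x) * e x)
        + of_real (2 * \<eta> * b x - 2 * dn x * a x) * e x) (at x)"
      unfolding p_def by (rule has_vector_derivative_mult[OF b' e])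
    also have "c b x * (\<i> * of_real (t x) * e x) + of_real (2 * \<eta> * b x - 2 * dn x * a x) * e x
        = 2 * of_real \<eta> * p x + 2 * c dn x * m x"
      using inv[of x] unfolding t_eq p_def m_def z_def of_real_diff of_real_mult c_def of_real_numeral by algebra
    finally show ?thesis .
  qed
  have m': "(m has_vector_derivative c dn x * (r x - p x)) (at x)" for x
  proof -
    have "(m has_vector_derivative - z x * (\<i> * of_real (t x) * e x) + - of_real (dn x * dn' x) * e x) (at x)"
      unfolding m_def by (rule has_vector_derivative_mult[OF has_vector_derivative_minus[OF z'] e])
    also have "- z x * (\<i> * of_real (t x) * e x) + - of_real (dn x * dn' x) * e x = c dn x * (r x - p x)"
      using inv[of x] det'[of x] ii
      unfolding t_eq p_def r_def z_def of_real_mult c_def by algebra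
    finally show ?thesis .
  qed
  have r': "(r has_vector_derivative - 2 * of_real \<eta> * r x - 2 * c dn x * m x) (at x)" for x
  proof -
    have "(r has_vector_derivative c (\<lambda>x. 1 / b x) x * (z x * z x) * (\<i> * of_real (t x) * e x)
       + (c (\<lambda>x. 1 / b x) x * (z x * of_real (dn x * dn' x) + of_real (dn x * dn' x) * z x)
        + of_real (- (2 * \<eta> * b x - 2 * dn x * a x) * (1 / b x)\<^sup>2) * (z x * z x)) * e x) (at x)"
      unfolding r_def
      by (rule has_vector_derivative_mult[OF has_vector_derivative_mult[OF ib' has_vector_derivative_mult[OF z' z']] e])
    also have "c (\<lambda>x. 1 / b x) x * (z x * z x) * (\<i> * of_real (t x) * e x)
       + (c (\<lambda>x. 1 / b x) x * (z x * of_real (dn x * dn' x) + of_real (dn x * dn' x) * z x)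
        + of_real (- (2 * \<eta> * b x - 2 * dn x * a x) * (1 / b x)\<^sup>2) * (z x * z x)) * e x
       = - 2 * of_real \<eta> * r x - 2 * c dn x * m x"
      using inv[of x] det'[of x] ii
      unfolding t_eq m_def r_def z_def of_real_mult of_real_diff of_real_minus of_real_power of_real_numeral c_def
      by algebra
    finally show ?thesis .
  qed
  \<comment> \<open>These eigenvector relations of the time part replace time derivatives, and so
    produce the eigenvalue 2 \<Omega>.\<close>
  have Op: "of_real \<Omega> * p x = \<i> * c a x * p x + \<i> * c b x * m x" for x
    using ii unfolding p_def m_def z_def by algebra
  have Or: "of_real \<Omega> * r x = - \<i> * (c b x - c dn' x) * m x - \<i> * c a x * r x" for x
    using inv[of x] det'[of x] ii unfolding r_def m_def z_def by algebra
  define U where "U = (\<lambda>x. \<i> * (p x - r x))"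
  define V where "V = (\<lambda>x. p x + r x)"
  define U1 where "U1 = (\<lambda>x. \<i> * (2 * of_real \<eta> * (p x + r x) + 4 * (c dn x * m x)))"
  define V1 where "V1 = (\<lambda>x. 2 * of_real \<eta> * (p x - r x))"
  have U': "(U has_vector_derivative U1 x) (at x)" for x
    using has_vector_derivative_mult_right[OF has_vector_derivative_diff[OF p' r'], of \<i> x]
    by (simp add: U_def U1_def algebra_simps)
  have V': "(V has_vector_derivative V1 x) (at x)" for x
    using has_vector_derivative_add[OF p' r', of x] by (simp add: V_def V1_def algebra_simps)
  have pr': "((\<lambda>x. p x + r x) has_vector_derivative 2 * of_real \<eta> * (p x - r x)) (at x)" for x
    using V' by (simp add: V_def V1_def)
  define U2 where "U2 = (\<lambda>x. \<i> * (2 * of_real \<eta> * (2 * of_real \<eta> * (p x - r x))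
      + 4 * (c dn x * (c dn x * (r x - p x)) + c dn' x * m x)))"
  define V2 where "V2 = (\<lambda>x. 2 * of_real \<eta> * ((2 * of_real \<eta> * p x + 2 * c dn x * m x)
      - (- 2 * of_real \<eta> * r x - 2 * c dn x * m x)))"
  have U1': "(U1 has_vector_derivative U2 x) (at x)" for x
    unfolding U1_def U2_def
    using has_vector_derivative_mult[OF c_deriv[OF dn_deriv] m', of x]
    by (intro has_vector_derivative_mult_right has_vector_derivative_add pr') (simp add: c_def)
  have V1': "(V1 has_vector_derivative V2 x) (at x)" for x
    unfolding V1_def V2_def by (intro has_vector_derivative_mult_right has_vector_derivative_diff p' r')
  have D: "D U = U1" "D V = V1" "D U1 = U2" "D V1 = V2"
    using vector_derivative_at[OF U'] vector_derivative_at[OF V'] vector_derivative_at[OF U1']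
      vector_derivative_at[OF V1'] by (simp_all add: fun_eq_iff)
  have diff: "twice_differentiable U" "twice_differentiable V"
    unfolding twice_differentiable_def D
    using differentiableI_vector[OF U'] differentiableI_vector[OF V'] differentiableI_vector[OF U1']
      differentiableI_vector[OF V1'] by simp_all
  have 2: "2 * c a x = 2 * (of_real \<eta>)\<^sup>2 + (c dn x)\<^sup>2 + of_real w"
      "2 * c b x = 2 * of_real \<eta> * c dn x + c dn' x" for x
    by (simp_all add: c_def a_def b_def lax_a_def lax_b_def field_simps)
  have "L_minus dn w V x = of_real (2 * \<Omega>) * U x" for x
  proof -
    have "L_minus dn w V x = - (1/2) * V2 x - (c dn x)\<^sup>2 * V x - of_real w * V x"
      by (simp add: L_minus_def D vector_derivative_at[OF V1'] c_def)
    then show ?thesis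
      using Op[of x] Or[of x] 2[of x] ii
      unfolding V2_def V_def U_def of_real_mult of_real_numeral by algebra
  qed
  moreover have "- L_plus dn w U x = of_real (2 * \<Omega>) * V x" for x
  proof -
    have "L_plus dn w U x = - (1/2) * U2 x - 3 * (c dn x)\<^sup>2 * U x - of_real w * U x"
      by (simp add: L_plus_def D vector_derivative_at[OF U1'] c_def)
    then show ?thesis
      using Op[of x] Or[of x] 2[of x] ii
      unfolding U2_def V_def U_def of_real_mult of_real_numeral by algebra
  qed
  ultimately have eq: "NLS_lin dn w (U, V) = ((\<lambda>x. of_real (2 * \<Omega>) * U x), (\<lambda>x. of_real (2 * \<Omega>) * V x))"
    by (simp add: NLS_lin_def fun_eq_iff)
  have "e (x + real P * T) = e x" for x
    by (simp add: e_def \<theta>_nT phase complex_eq_iff cos_diff sin_diff)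
  then have per: "U (x + real P * T) = U x \<and> V (x + real P * T) = V x" for x
    using dn_nT[of x P]
    by (simp add: U_def V_def p_def r_def z_def c_def a_def b_def lax_a_def lax_b_def)
  have "(U, V) \<noteq> ((\<lambda>x. 0), (\<lambda>x. 0))"
  proof
    assume "(U, V) = ((\<lambda>x. 0), (\<lambda>x. 0))"
    then have "p 0 - r 0 = 0" "p 0 + r 0 = 0" by (auto simp: U_def V_def fun_eq_iff)
    \<comment> \<open>This is impossible because \<open>cis\<close> has modulus 1 and
      \<open>b\<close> is never 0.\<close>
    then have "p 0 = 0" by simp
    then show False using b_nz[of 0] by (simp add: p_def c_def e_def)
  qed
  with diff eq per have "periodic_eigenfunction dn w (real P * T) (of_real (2 * \<Omega>)) U V"
    by (simp add: periodic_eigenfunction_def)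
  then show ?thesis using \<Omega> by (intro exI[of _ "of_real (2 * \<Omega>)"]) auto
qed


section \<open>Range of the Floquet phase\<close>

lemma floquet_integrand_integrable:
  assumes "(1 - kc) / 2 < \<eta>"
  shows "(\<lambda>x. 2 * Om \<eta> * dn x / lax_b \<eta> x) integrable_on {x..y}"
  using lax_b_pos(1)[OF assms]
  by (intro integrable_continuous_real continuous_intros continuous_dn continuous_lax_b)
    (auto simp: less_imp_neq[symmetric])

lemma continuous_floquet_phase:
  assumes "(1 - kc) / 2 < \<eta>1"
  shows "continuous_on {\<eta>1..\<eta>2} floquet_phase"
proof -
  have "continuous_on ({\<eta>1..\<eta>2} \<times> cbox 0 T) (\<lambda>(\<eta>, x). 2 * Om \<eta> * dn x / lax_b \<eta> x)"
  proof -
    have "\<eta> * dn x + dn' x / 2 \<noteq> 0" if "\<eta>1 \<le> \<eta>" for \<eta> x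
      using lax_b_pos(1)[of \<eta> x] assms that by (simp add: lax_b_def)
    then show ?thesis
      unfolding Om_def lax_b_def split_beta
      by (intro continuous_intros continuous_on_compose2[OF continuous_dn[of UNIV]]
          continuous_on_compose2[OF continuous_dn'[of UNIV]]) auto
  qed
  from integral_continuous_on_param[OF this] show ?thesis
    by (simp add: floquet_phase_def[abs_def])
qed

text \<open>Interchanging the components of the Lax eigenvector turns the phase density \<open>2 \<Omega> dn / b\<close>
  into \<open>2 \<Omega> dn / (b - dn')\<close>, up to the derivative of the argument of \<open>a + \<i> \<Omega>\<close>. So the phase is
  at least the change of \<open>2 arg (a + \<i> \<Omega>)\<close> over half a period, which for the value of \<open>\<eta>\<close>
  chosen here is exactly \<open>\<pi>\<close>.\<close>

lemma floquet_phase_large: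
  obtains \<eta> where "(1 - kc) / 2 < \<eta>" "\<eta> < (1 + kc) / 2" "pi \<le> floquet_phase \<eta>"
proof (cases "k = 0")
  case True
  then have kc: "kc = 1" and w: "w = - 1" unfolding kc_def w_def by simp_all
  have dn: "dn x = 1" "dn' x = 0" for x unfolding dn_eq dn'_def using True by simp_all
  have "ellF k pi - pi = ellF k 0 - 0"
  proof (rule DERIV_isconst_all[where f="\<lambda>t. ellF k t - t"])
    show "\<forall>t. ((\<lambda>t. ellF k t - t) has_real_derivative 0) (at t)"
      using DERIV_diff[OF ellF_deriv DERIV_ident] True by simp
  qed
  then have T: "T = pi" using ellF_add_pi[of 0] by (simp add: ellF_0)
  \<comment> \<open>Here the phase at \<eta> equals 2 pi sqrt(1 - \<eta>^2), which is pi at this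
    point.\<close>
  have "Om (sqrt 3 / 2) = sqrt ((sqrt 3 / 4)\<^sup>2)"
    by (simp add: Om_def kc power_divide)
  then have Om: "Om (sqrt 3 / 2) = sqrt 3 / 4" by simp
  have "sqrt 3 < sqrt 4" by (rule real_sqrt_less_mono) simp
  then have "sqrt 3 < 2" by simp
  moreover have "floquet_phase (sqrt 3 / 2) = pi"
    by (simp add: floquet_phase_def lax_b_def dn Om T)
  ultimately show ?thesis using that[of "sqrt 3 / 2"] by (simp add: kc)
next
  case False
  then have kc1: "kc < 1" using k_nonneg kc_less_1 by simp
  \<comment> \<open>Solves (1 + kc^2) \<eta>^2 = 4 \<kappa>^2, which makes the product of
    \<open>lax_a\<close> at 0 and at \<open>K\<close> equal to minus the square of
    \<open>Om\<close>. At \<open>k = 0\<close> it would be 0, outside the band.\<close>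
  define \<eta> where "\<eta> = (1 - kc\<^sup>2) / (2 * sqrt (1 + kc\<^sup>2))"
  have sq_pos: "0 < 1 + kc\<^sup>2" by (simp add: add_pos_nonneg)
  have fac: "1 - kc\<^sup>2 = (1 - kc) * (1 + kc)" by (simp add: algebra_simps power2_eq_square)
  \<comment> \<open>That \<eta> lies in the band amounts to 1 - kc < sqrt(1 + kc^2) < 1 +
    kc.\<close>
  have "sqrt (1 + kc\<^sup>2) < 1 + kc"
    using kc_pos by (intro real_less_lsqrt) (auto simp: power2_eq_square algebra_simps)
  then have "(1 - kc) * sqrt (1 + kc\<^sup>2) < (1 - kc) * (1 + kc)"
    using kc1 by (intro mult_strict_left_mono) auto
  then have \<eta>1: "(1 - kc) / 2 < \<eta>"
    using sq_pos by (simp add: \<eta>_def fac field_simps)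
  have "1 - kc < 1" "1 \<le> sqrt (1 + kc\<^sup>2)" using kc_pos by auto
  then have "1 - kc < sqrt (1 + kc\<^sup>2)" by linarith
  then have "(1 - kc) * (1 + kc) < sqrt (1 + kc\<^sup>2) * (1 + kc)"
    using kc_pos by (intro mult_strict_right_mono) auto
  then have \<eta>2: "\<eta> < (1 + kc) / 2"
    using sq_pos by (simp add: \<eta>_def fac field_simps)
  have \<Omega>_pos: "0 < Om \<eta>" using Om_sq(3)[OF \<eta>1] \<eta>2 by simp
  define \<kappa> where "\<kappa> = (1 - kc\<^sup>2) / 4"
  have \<eta>_sq: "(1 + kc\<^sup>2) * \<eta>\<^sup>2 = 4 * \<kappa>\<^sup>2"
    using sq_pos by (simp add: \<eta>_def \<kappa>_def power_divide power_mult_distrib field_simps)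
  have "(Om \<eta>)\<^sup>2 = \<kappa>\<^sup>2 - \<eta>^4"
    using Om_sq(1)[OF \<eta>1 less_imp_le[OF \<eta>2]] \<eta>_sq by (simp add: \<kappa>_def)
  define K where "K = ellF k (pi / 2)"
  have T_K: "T = 2 * K" by (simp add: T_def K_def ellK_def)
  have K_pos: "0 < K" using T_pos T_K by simp
  have am_end: "jacobi_am 0 k = 0" "jacobi_am K k = pi / 2"
    using am_ellF[of 0] am_ellF[of "pi / 2"] unfolding K_def ellF_0 .
  have dn_end: "dn 0 = 1" "dn K = kc"
    unfolding dn_eq sn_def am_end kc_def by simp_all
  have a_end: "lax_a \<eta> 0 = \<kappa> + \<eta>\<^sup>2" "lax_a \<eta> K = - (\<kappa> - \<eta>\<^sup>2)"
    by (simp_all add: lax_a_def dn_end w_eq \<kappa>_def field_simps)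
  have "0 < \<kappa>" using kc1 kc_pos by (simp add: \<kappa>_def power_less_one_iff)
  then have a0: "0 < lax_a \<eta> 0" by (simp add: a_end add_pos_nonneg)
  \<comment> \<open>The two arctangent arguments are thus reciprocal up to sign, so the angles add
    up to a right angle.\<close>
  have "lax_a \<eta> 0 * - lax_a \<eta> K = (Om \<eta>)\<^sup>2"
    unfolding a_end \<open>(Om \<eta>)\<^sup>2 = _\<close> by (simp add: algebra_simps power2_eq_square power4_eq_xxxx)
  then have "- lax_a \<eta> K / Om \<eta> = 1 / (lax_a \<eta> 0 / Om \<eta>)"
    using a0 \<Omega>_pos by (simp add: field_simps power2_eq_square)
  then have "arctan (- lax_a \<eta> K / Om \<eta>) = pi / 2 - arctan (lax_a \<eta> 0 / Om \<eta>)"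
    using Transcendental.arctan_inverse[of "lax_a \<eta> 0 / Om \<eta>"] a0 \<Omega>_pos by simp
  then have arc: "2 * arctan (lax_a \<eta> 0 / Om \<eta>) - 2 * arctan (lax_a \<eta> K / Om \<eta>) = pi"
    by (simp add: arctan_minus)
  define A where "A = (\<lambda>x. - 2 * arctan (lax_a \<eta> x / Om \<eta>))"
  define A' where "A' = (\<lambda>x. - 2 * Om \<eta> * (dn x * dn' x) / ((lax_a \<eta> x)\<^sup>2 + (Om \<eta>)\<^sup>2))"
  have A: "(A has_real_derivative A' x) (at x)" for x
  proof -
    have "(A has_real_derivative - 2 * (1 / (1 + (lax_a \<eta> x / Om \<eta>)\<^sup>2) * (dn x * dn' x / Om \<eta>))) (at x)"
      unfolding A_def using \<Omega>_pos
      by (auto intro!: derivative_eq_intros lax_a_deriv simp: inverse_eq_divide)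
    also have "- 2 * (1 / (1 + (lax_a \<eta> x / Om \<eta>)\<^sup>2) * (dn x * dn' x / Om \<eta>)) = A' x"
    proof -
      have "1 + (lax_a \<eta> x / Om \<eta>)\<^sup>2 = ((lax_a \<eta> x)\<^sup>2 + (Om \<eta>)\<^sup>2) / (Om \<eta>)\<^sup>2"
        using \<Omega>_pos by (simp add: field_simps)
      then show ?thesis using \<Omega>_pos by (simp add: A'_def power2_eq_square)
    qed
    finally show ?thesis .
  qed
  have A'_le: "A' x \<le> 2 * Om \<eta> * dn x / lax_b \<eta> x" for x
  proof -
    have pos: "0 < lax_b \<eta> x" "0 < lax_b \<eta> x - dn' x" using lax_b_pos[OF \<eta>1, of x] by simp_all
    \<comment> \<open>The constant determinant rewrites the denominator of \<open>A'\<close> as b (b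
      - dn'), and partial fractions remain.\<close>
    have "2 * Om \<eta> * dn x / lax_b \<eta> x - A' x = 2 * Om \<eta> * dn x / (lax_b \<eta> x - dn' x)"
      unfolding A'_def lax_det[OF \<eta>1 less_imp_le[OF \<eta>2]] using pos by (simp add: field_simps)
    also have "\<dots> \<ge> 0" using pos \<Omega>_pos dn_pos[of x] by simp
    finally show ?thesis by simp
  qed
  have "(A' has_integral A K - A 0) {0..K}"
    using K_pos by (intro has_integral_real_deriv[OF A]) simp
  then have "A K - A 0 \<le> integral {0..K} (\<lambda>x. 2 * Om \<eta> * dn x / lax_b \<eta> x)"
    using floquet_integrand_integrable[OF \<eta>1] A'_le by (intro has_integral_le[OF _ integrable_integral])
  \<comment> \<open>The second half period only adds a positive amount.\<close>
  also have "\<dots> \<le> floquet_phase \<eta>"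
    unfolding floquet_phase_def using floquet_integrand_integrable[OF \<eta>1] K_pos \<Omega>_pos dn_pos lax_b_pos(1)[OF \<eta>1]
    by (intro integral_subset_le) (auto simp: T_K less_imp_le)
  finally have "pi \<le> floquet_phase \<eta>" using arc by (simp add: A_def)
  then show ?thesis using that \<eta>1 \<eta>2 by blast
qed

lemma subharmonic_instability:
  assumes "2 \<le> P"
  shows "\<exists>\<mu> U V. Re \<mu> > 0 \<and> periodic_eigenfunction dn w (real P * T) \<mu> U V"
proof -
  obtain \<eta>1 where \<eta>1: "(1 - kc) / 2 < \<eta>1" "\<eta>1 < (1 + kc) / 2" "pi \<le> floquet_phase \<eta>1"
    using floquet_phase_large by blast
  define \<eta>2 where "\<eta>2 = (1 + kc) / 2"
  have "Om \<eta>2 = 0" by (simp add: Om_def \<eta>2_def power_divide)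
  then have end0: "floquet_phase \<eta>2 = 0" by (simp add: floquet_phase_def)
  \<comment> \<open>Here \<open>P \<ge> 2\<close> enters: the target value lies between the phase at
    the upper end and the phase at \<eta>1.\<close>
  have "2 * pi / real P \<le> pi" using assms by (simp add: field_simps)
  then have "\<exists>\<eta>. \<eta>1 \<le> \<eta> \<and> \<eta> \<le> \<eta>2 \<and> floquet_phase \<eta> = 2 * pi / real P"
    using \<eta>1 by (intro IVT2' continuous_floquet_phase) (auto simp: end0, simp_all add: \<eta>2_def)
  then obtain \<eta> where \<eta>: "\<eta>1 \<le> \<eta>" "\<eta> \<le> \<eta>2" "floquet_phase \<eta> = 2 * pi / real P" by blast
  have "\<eta> \<noteq> \<eta>2" using \<eta>(3) end0 assms by auto
  then show ?thesis
    using \<eta> \<eta>1 assms by (intro floquet_eigenfunction[of \<eta>]) (auto simp: \<eta>2_def)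
qed


end

theorem theorem9p3:
  fixes k \<omega> T :: real and \<phi> :: "real \<Rightarrow> real"
  assumes "0 \<le> k" and "k < 1"
    and "\<phi> = (\<lambda>x. jacobi_dn x k)"
    and "\<omega> = (1/2) * (k\<^sup>2 - 2)"
    and "T = 2 * ellK k"
  shows "(\<forall>\<mu> U V. periodic_eigenfunction \<phi> \<omega> T \<mu> U V \<longrightarrow> Re \<mu> = 0) \<and>
         (\<forall>P::nat. P \<ge> 2 \<longrightarrow>
            (\<exists>\<mu> U V. Re \<mu> > 0 \<and> periodic_eigenfunction \<phi> \<omega> (real P * T) \<mu> U V))"
proof -
  interpret elliptic_modulus k by unfold_locales (use assms in auto)
  have "\<phi> = dn" "\<omega> = w" "T = elliptic_modulus.T k"
    using assms by (simp_all add: dn_def w_def T_def fun_eq_iff)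
  then show ?thesis using coperiodic_stability subharmonic_instability by simp
qed

end
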